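(* Let $d\in\mathbb{N}$, $\beta>0$, $\ell$ the largest integer strictly smaller than $\beta$, $L_0,\dots,L_\ell,L_\beta>0$, $R>0$, $s\in\mathbb{N}_0$ with $s<\beta$, $\mathbf{v}=(v_1,\dots,v_s)$ a tuple of $s$ unit vectors in $\mathbb{R}^d$, $C_{\mathsf{noise}},C_{\mathsf{cvrsc}}>0$, and $p\in[1,\infty)$. Then there are constants $n_0,C>0$ large enough, where $n_0$ depends only on $\beta,d,L_0,\dots,L_\ell,L_\beta,R,C_{\mathsf{noise}},C_{\mathsf{cvrsc}}$ and potentially on $p$, and $C$ depends only on $\beta,d,L_\beta,C_{\mathsf{noise}},C_{\mathsf{cvrsc}}$ and potentially on $p$, with the following property. Consider the nonparametric regression model described in the context, with noise distribution $P^\varepsilon$ satisfying (Noise) with constant $C_{\mathsf{noise}}$ and design points $x_1,\dots,x_n$ satisfying (CoverScaled) with constant $C_{\mathsf{cvrsc}}$. Assume $n\ge n_0$. Then $$\forall x_0\in[0,R]^d:\ \inf_{\hat g}\sup_{f^\star\in\mathcal{F}_{d,\beta}}\mathbf{P}_{f^\star}\bigg(C\,\big|\hat g(x_0)-D^s_{\mathbf{v}}f^\star(x_0)\big|\ge\Big(\frac{R^d}{n}\Big)^{\frac{\beta-s}{2\beta+d}}\bigg)\ge\tfrac14,$$ $$\inf_{\hat g}\sup_{f^\star\in\mathcal{F}_{d,\beta}}\mathbf{P}_{f^\star}\bigg(C\sup_{x\in[0,R]^d}\big|\hat g(x)-D^s_{\mathbf{v}}f^\star(x)\big|\ge\Big(\frac{R^d\log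 n}{n}\Big)^{\frac{\beta-s}{2\beta+d}}\bigg)\ge\tfrac14,$$ $$\inf_{\hat g}\sup_{f^\star\in\mathcal{F}_{d,\beta}}\mathbf{P}_{f^\star}\bigg(C\,R^{-d/p}\big\|\hat g-D^s_{\mathbf{v}}f^\star\big\|_{L^p([0,R]^d)}\ge\Big(\frac{R^d}{n}\Big)^{\frac{\beta-s}{2\beta+d}}\bigg)\ge\tfrac14.$$ Here all infima range over all estimators $\hat g$ of $D^s_{\mathbf{v}}f^\star$ based on the observations $Y_1,\dots,Y_n$.
   Context: $\mathcal{F}_{d,\beta}$ is here the set of real-valued functions $f:\mathbb{R}^d\to\mathbb{R}$ that are $\ell$ times differentiable with $\sup_x\|D^kf(x)\|_{\mathsf{op}}\le L_k$ for $k=0,\dots,\ell$ and $\|D^\ell f(x)-D^\ell f(\tilde x)\|_{\mathsf{op}}\le L_\beta\|x-\tilde x\|_2^{\beta-\ell}$ for all $x,\tilde x\in\mathbb{R}^d$, where $D^kf(x)$ is the $k$-th derivative as a symmetric $k$-linear form, $\|A\|_{\mathsf{op}}=\sup\{|A(w_1,\dots,w_k)|:\|w_i\|_2=1\}$, and $\|\cdot\|_2$ is the Euclidean norm. $D^s_{\mathbf{v}}f(x)=D^sf(x)(v_1,\dots,v_s)$ is the $s$-th directional derivative, with $D^0f=f$. Model: $n\in\mathbb{N}$, $x_1,\dots,x_n\in\mathbb{R}^d$, and for $f^\star\in\mathcal{F}_{d,\beta}$, $Y_i=f^\star(x_i)+\varepsilon_i$, $i=1,\dots,n$, with $\varepsilon_1,\dots,\varepsilon_n$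 i.i.d. centered real random variables with distribution $P^\varepsilon$; $\mathbf{P}_{f^\star}$ is the corresponding probability measure. (Noise): for all $v,w\in\mathbb{R}$, $\mathrm{KL}(v+P^\varepsilon,w+P^\varepsilon)\le C_{\mathsf{noise}}|v-w|^2$, where $\mathrm{KL}$ is the Kullback–Leibler divergence and $v+P$ is the distribution $P$ shifted by $v$. (CoverScaled): for all $z\in[0,R]^d$ and $r>0$, $\frac1n\#\{i\in\{1,\dots,n\}:\|x_i-z\|_2<r\}\le\max\big(\frac1n,C_{\mathsf{cvrsc}}(\frac rR)^d\big)$. *)

theory Defs
  imports "HOL-Probability.Probability"
begin

text \<open>
  The value \<open>iter_deriv f [v\<^sub>1, \<dots>, v\<^sub>k] x\<close> is \<open>D\<^sup>k f(x)(v\<^sub>1, \<dots>, v\<^sub>k)\<close>: a \<open>k\<close>-linear form is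
  represented by a function on lists of length \<open>k\<close>, and \<open>D\<^sup>k f\<close> is the Frechet derivative of
  \<open>D\<^sup>k\<^sup>-\<^sup>1 f\<close>.  The iterated derivative is symmetric wherever it exists, so the order of the
  list is immaterial.
\<close>

primrec iter_deriv :: "('a::real_normed_vector \<Rightarrow> real) \<Rightarrow> 'a list \<Rightarrow> 'a \<Rightarrow> real" where
  "iter_deriv f [] = f"
| "iter_deriv f (v # vs) = (\<lambda>x. frechet_derivative (iter_deriv f vs) (at x) v)"

text \<open>
  A map into the (finite-dimensional) space of \<open>j\<close>-linear forms on a Euclidean space is Frechet
  differentiable iff its evaluation at every tuple of vectors is.
\<close>

definition times_differentiable :: "nat \<Rightarrow> ('a::euclidean_space \<Rightarrow> real) \<Rightarrow> bool" where
  "times_differentiable k f \<longleftrightarrow>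
     (\<forall>vs x. length vs < k \<longrightarrow> iter_deriv f vs differentiable (at x))"

definition form_norm :: "nat \<Rightarrow> ('a::euclidean_space list \<Rightarrow> real) \<Rightarrow> ennreal" where
  "form_norm k A = (SUP ws\<in>{ws. length ws = k \<and> (\<forall>w\<in>set ws. norm w = 1)}. ennreal \<bar>A ws\<bar>)"

text \<open>For \<open>\<beta> > 0\<close>, the largest integer strictly smaller than \<open>\<beta>\<close>.\<close>

definition strict_floor :: "real \<Rightarrow> nat" where
  "strict_floor \<beta> = nat (\<lceil>\<beta>\<rceil> - 1)"

definition holder_class :: "real \<Rightarrow> (nat \<Rightarrow> real) \<Rightarrow> real \<Rightarrow> ('a::euclidean_space \<Rightarrow> real) set" where
  "holder_class \<beta> L L\<^sub>\<beta> =
     {f. times_differentiable (strict_floor \<beta>) f \<and>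
         (\<forall>k\<le>strict_floor \<beta>. (SUP x. form_norm k (\<lambda>ws. iter_deriv f ws x)) \<le> ennreal (L k)) \<and>
         (\<forall>x x'. form_norm (strict_floor \<beta>) (\<lambda>ws. iter_deriv f ws x - iter_deriv f ws x')
                   \<le> ennreal (L\<^sub>\<beta> * norm (x - x') powr (\<beta> - real (strict_floor \<beta>))))}"

definition cube :: "real \<Rightarrow> (real ^ 'd) set" where
  "cube R = {x. \<forall>i. 0 \<le> x $ i \<and> x $ i \<le> R}"

text \<open>
  In the library, \<^term>\<open>KL_divergence b Q P\<close> is the divergence of \<open>P\<close> from \<open>Q\<close> (that is,
  \<open>KL(P, Q)\<close>, with reversed arguments), and it is only meaningful if \<open>P\<close> is absolutely continuous
  with respect to \<open>Q\<close> and the log-density is integrable.  In all other cases \<open>KL(P, Q) = \<infinity>\<close>.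
\<close>

definition kl_div :: "'a measure \<Rightarrow> 'a measure \<Rightarrow> ereal" where
  "kl_div P Q =
     (if absolutely_continuous Q P \<and> integrable P (entropy_density (exp 1) Q P)
      then ereal (KL_divergence (exp 1) Q P) else \<infinity>)"

definition shift :: "real \<Rightarrow> real measure \<Rightarrow> real measure" where
  "shift v P = distr P borel (\<lambda>t. v + t)"

definition centered_distribution :: "real measure \<Rightarrow> bool" where
  "centered_distribution P \<longleftrightarrow>
     prob_space P \<and> sets P = sets borel \<and> integrable P (\<lambda>t. t) \<and> integral\<^sup>L P (\<lambda>t. t) = 0"

definition noise_cond :: "real \<Rightarrow> real measure \<Rightarrow> bool" where
  "noise_cond C P \<longleftrightarrow> (\<forall>v w. kl_div (shift v P) (shift w P) \<le> ereal (C * \<bar>v - w\<bar>\<^sup>2))"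

definition cover_scaled :: "real \<Rightarrow> real \<Rightarrow> nat \<Rightarrow> (nat \<Rightarrow> real ^ 'd) \<Rightarrow> bool" where
  "cover_scaled C R n x \<longleftrightarrow>
     (\<forall>z\<in>cube R. \<forall>r>0.
        real (card {i\<in>{1..n}. norm (x i - z) < r}) / real n
          \<le> max (1 / real n) (C * (r / R) ^ CARD('d)))"

text \<open>The law of \<open>(Y\<^sub>1, \<dots>, Y\<^sub>n)\<close>, where \<open>Y\<^sub>i = f(x\<^sub>i) + \<epsilon>\<^sub>i\<close> with i.i.d. \<open>\<epsilon>\<^sub>i\<close> distributed as \<open>P\<close>.\<close>

definition obs_law :: "real measure \<Rightarrow> nat \<Rightarrow> (nat \<Rightarrow> 'a) \<Rightarrow> ('a \<Rightarrow> real) \<Rightarrow> (nat \<Rightarrow> real) measure" where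
  "obs_law P n x f =
     distr (\<Pi>\<^sub>M i\<in>{1..n}. P) (\<Pi>\<^sub>M i\<in>{1..n}. borel) (\<lambda>\<epsilon>. \<lambda>i\<in>{1..n}. f (x i) + \<epsilon> i)"

text \<open>
  Estimators of a function: \<open>g y\<close> is the estimated function for the data \<open>y\<close>, and each of its
  values is a random variable.  For the \<open>L\<^sup>p\<close> loss the estimated functions must moreover be
  measurable on the cube.  This is weaker than joint measurability in \<open>(y, x)\<close>.
\<close>

definition estimators :: "nat \<Rightarrow> ((nat \<Rightarrow> real) \<Rightarrow> 'a \<Rightarrow> real) set" where
  "estimators n = {g. \<forall>x. (\<lambda>y. g y x) \<in> borel_measurable (\<Pi>\<^sub>M i\<in>{1..n}. borel)}"

definition path_measurable_estimators ::
    "real \<Rightarrow> nat \<Rightarrow> ((nat \<Rightarrow> real) \<Rightarrow> real ^ 'd \<Rightarrow> real) set" where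
  "path_measurable_estimators R n =
     {g\<in>estimators n. \<forall>y\<in>space (\<Pi>\<^sub>M i\<in>{1..n}. borel). g y \<in> borel_measurable (lebesgue_on (cube R))}"

text \<open>The \<open>L\<^sup>p\<close> norm of \<open>h\<close>, with value \<open>\<infinity>\<close> if \<open>h\<close> is measurable but not in \<open>L\<^sup>p\<close>.\<close>

definition Lp_norm :: "real \<Rightarrow> 'a measure \<Rightarrow> ('a \<Rightarrow> real) \<Rightarrow> ennreal" where
  "Lp_norm p M h =
     (let I = \<integral>\<^sup>+ x. ennreal (\<bar>h x\<bar> powr p) \<partial>M
      in if I = \<infinity> then \<infinity> else ennreal (enn2real I powr (1 / p)))"

text \<open>
  The probability of an event about the observations.  For measurable events (and events in the
  completion) the outer measure is the probability; it is used since a supremum over uncountably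
  many points, or an integral, of an estimator's error need not be a measurable function of the data.
\<close>

definition obs_prob ::
    "real measure \<Rightarrow> nat \<Rightarrow> (nat \<Rightarrow> 'a) \<Rightarrow> ('a \<Rightarrow> real) \<Rightarrow> ((nat \<Rightarrow> real) \<Rightarrow> bool) \<Rightarrow> ennreal" where
  "obs_prob P n x f E =
     outer_measure_of (obs_law P n x f) {y\<in>space (\<Pi>\<^sub>M i\<in>{1..n}. borel). E y}"

end

theory Submission
  imports Defs "HOL-Real_Asymp.Real_Asymp"
begin

text \<open>
  Each bound comes from a finite testing problem inside the Hoelder class.  A hypothesis is
  a sum \<open>f w = (\<Sum>z\<in>w. c * h powr \<beta> * K ((\<cdot> - z) / h))\<close> of copies of one kernel \<open>K\<close> with disjoint
  supports, placed at a set \<open>w\<close> of centres.  The bandwidth solves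
  \<open>h\<^sup>2\<^sup>\<beta>\<^sup>+\<^sup>d = R\<^sup>d * \<tau> / n\<close>, with \<open>\<tau> = 1\<close> for the pointwise and the \<open>L\<^sup>p\<close> risk and \<open>\<tau> = ln n\<close> for the uniform
  risk.  Three things are then in balance.  The bound for the \<open>\<beta>\<close>-Hoelder constant of \<open>f w\<close> does not depend on
  \<open>h\<close> and is small if \<open>c\<close> is, while the bounds on the lower derivatives are met as soon as \<open>h\<close> is small,
  that is, for large \<open>n\<close> (\<open>f_in_holder_class\<close>).  Adding or removing one bump changes the derivative
  \<open>D\<^sup>s\<close> near its centre by the order of \<open>h powr (\<beta> - s)\<close>, which is the rate
  (\<open>signal_near_center\<close>).  And by the design and noise conditions one bump carries Kullback-Leibler
  information at most \<open>\<epsilon> * \<tau>\<close>, where \<open>\<epsilon>\<close> is small if \<open>c\<close> is (\<open>information_one_bump\<close>).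

  An estimator with small error for all hypotheses would identify \<open>w\<close>.  For \<open>\<tau> = 1\<close> each single bump
  is barely detectable.  With one bump at \<open>x\<^sub>0\<close> this is the pointwise bound; with bumps on a grid of
  about \<open>(R / h)\<^sup>d\<close> centres, a positive fraction of the bumps must be misjudged, which forces an \<open>L\<^sup>p\<close>
  error of the order of the rate.  Both are instances of Assouad's lemma (\<open>assouad\<close>).  For
  \<open>\<tau> = ln n\<close> the hypotheses with exactly one bump on that grid are used: there are \<open>M\<close> of them with
  \<open>ln M\<close> of order \<open>ln n\<close>, and an information of \<open>\<epsilon> * ln n\<close> does not suffice to tell \<open>M\<close> hypotheses
  apart (\<open>fano\<close>).

  All information-theoretic estimates are drawn from one inequality, the Donsker-Varadhan formula for
  an indicator function: \<open>\<lambda> * P A \<le> KL(P, Q) + ln (1 + (exp \<lambda> - 1) * Q A)\<close> for every \<open>\<lambda> \<ge> 0\<close>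
  (\<open>event_change_of_measure\<close>).  With \<open>\<lambda> = 1 / 16\<close> it bounds the total variation, and with
  \<open>\<lambda> = ln M\<close> it gives Fano's inequality.

  The constant \<open>C\<close> has to serve all tuples \<open>v\<^sub>1, \<dots>, v\<^sub>s\<close> of directions at once, so the derivative of the kernel
  must have a lower bound that is uniform in them.  This comes from one bump function \<open>\<psi>\<close>: by the mean value theorem
  along the line in direction \<open>v\<close>, the derivative \<open>D\<^sub>v g\<close> of a function \<open>g\<close> supported in a ball of radius
  \<open>r\<close> cannot be everywhere smaller than \<open>sup \<bar>g\<bar> / (2 * r + 1)\<close>.  Iterating this gives a point where
  \<open>\<bar>D\<^sup>s \<psi>(v\<^sub>1, \<dots>, v\<^sub>s)\<bar>\<close> is at least a constant that depends only on the dimension and \<open>s\<close>, and \<open>K\<close> is \<open>\<psi>\<close>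
  recentred at that point (\<open>kernel_exists\<close>).

  The losses need not be measurable functions of the data.  If the outer probability of a large loss is
  small under each hypothesis, the large-loss events are contained in measurable events of small
  probability, and a measurable choice among the finitely many hypotheses that remain possible replaces
  the estimator (\<open>small_outer_measure_cover\<close>, \<open>finite_measurable_selector\<close>).
\<close>

section \<open>Change of measure for the regression model\<close>

text \<open>
  The Donsker-Varadhan inequality for the test function \<open>lam\<close> times the indicator of \<open>A\<close>.  If \<open>r\<close> is the
  density and \<open>c\<close> is the \<open>Q\<close>-mean of \<open>exp (lam * indicator A)\<close>, the claim follows by integrating
  \<open>ln u \<le> u - 1\<close> at \<open>u = exp (lam * indicator A) / (r * c)\<close> with respect to \<open>P = density Q r\<close>, since \<open>u\<close>
  has \<open>P\<close>-mean at most 1.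
\<close>

lemma event_change_of_measure:
  fixes Q :: "'a measure" and r :: "'a \<Rightarrow> ennreal"
  assumes Q: "prob_space Q" and P: "prob_space (density Q r)" 
    and [measurable]: "r \<in> borel_measurable Q"
    and fin: "AE y in density Q r. r y \<noteq> \<top>"
    and int: "integrable (density Q r) (\<lambda>y. ln (enn2real (r y)))"
    and le: "(\<integral>y. ln (enn2real (r y)) \<partial>density Q r) \<le> K"
    and A[measurable]: "A \<in> sets Q" and lam: "0 \<le> lam"
  shows "lam * measure (density Q r) A \<le> K + ln (1 + (exp lam - 1) * measure Q A)"
proof -
  interpret Q: prob_space Q by fact
  interpret P: prob_space "density Q r" by fact
  define c where "c = 1 + (exp lam - 1) * measure Q A"
  have e1: "exp lam \<ge> 1" using lam by simp
  have c: "c \<ge> 1" unfolding c_def using e1 by simp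
  define \<phi> where "\<phi> = (\<lambda>y. lam * indicator A y :: real)"
  define h where "h = (\<lambda>y. exp (\<phi> y) / enn2real (r y))"
  have [measurable]: "\<phi> \<in> borel_measurable Q" "h \<in> borel_measurable Q"
    unfolding \<phi>_def h_def by measurable
  have pos: "AE y in density Q r. r y \<noteq> 0"
    by (subst AE_density) auto
  have nnh: "(\<integral>\<^sup>+ y. ennreal (h y) \<partial>density Q r) \<le> ennreal c"
  proof -
    have "(\<integral>\<^sup>+ y. ennreal (h y) \<partial>density Q r) = (\<integral>\<^sup>+ y. r y * ennreal (h y) \<partial>Q)"
      by (rule nn_integral_density) measurable
    also have "\<dots> \<le> (\<integral>\<^sup>+ y. ennreal (exp (\<phi> y)) \<partial>Q)"
    proof (rule nn_integral_mono_AE)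
      have "AE y in Q. 0 < r y \<longrightarrow> r y \<noteq> \<top>" using fin by (subst (asm) AE_density) auto
      then show "AE y in Q. r y * ennreal (h y) \<le> ennreal (exp (\<phi> y))"
      proof eventually_elim
        case (elim y)
        show ?case
        proof (cases "r y = 0")
          case False
          then have "0 < r y" by (simp add: zero_less_iff_neq_zero)
          with elim have t: "r y \<noteq> \<top>" by auto
          define t where "t = enn2real (r y)"
          have rt: "r y = ennreal t" "t > 0" using t False \<open>0 < r y\<close>
            by (auto simp: t_def enn2real_positive_iff top.not_eq_extremum)
          show ?thesis unfolding h_def rt using rt(2)
            by (simp add: ennreal_mult[symmetric])
        qed simp
      qed
    qed
    also have "\<dots> = ennreal c"
    proof -
      have "(\<integral>\<^sup>+ y. ennreal (exp (\<phi> y)) \<partial>Q) = (\<integral>\<^sup>+ y. ennreal (1 + (exp lam - 1) * indicator A y) \<partial>Q)"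
        by (rule nn_integral_cong) (auto simp: \<phi>_def split: split_indicator)
      also have "\<dots> = ennreal (\<integral> y. (1 + (exp lam - 1) * indicator A y) \<partial>Q)"
        using e1 by (intro nn_integral_eq_integral) (auto simp: Q.emeasure_eq_measure intro!: integrable_real_mult_indicator)
      also have "(\<integral> y. (1 + (exp lam - 1) * indicator A y) \<partial>Q) = c"
        by (subst Bochner_Integration.integral_add) (auto simp: c_def Q.prob_space Q.emeasure_eq_measure)
      finally show ?thesis .
    qed
    finally show ?thesis .
  qed
  have h0: "h y \<ge> 0" for y by (simp add: h_def)
  have hint: "integrable (density Q r) h"
    by (rule integrableI_nonneg) (use nnh h0 in \<open>auto intro: le_less_trans\<close>)
  have hle: "(\<integral>y. h y \<partial>density Q r) \<le> c"
  proof -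
    have "ennreal (\<integral>y. h y \<partial>density Q r) = (\<integral>\<^sup>+ y. ennreal (h y) \<partial>density Q r)"
      using hint h0 by (simp add: nn_integral_eq_integral)
    then show ?thesis using nnh c by (metis ennreal_le_iff order.trans zero_le_one)
  qed
  have phint: "integrable (density Q r) \<phi>"
    unfolding \<phi>_def by (intro integrable_mult_right integrable_real_indicator) (auto simp: P.emeasure_eq_measure)
  have "lam * measure (density Q r) A - (\<integral>y. ln (enn2real (r y)) \<partial>density Q r)
     = (\<integral>y. \<phi> y - ln (enn2real (r y)) \<partial>density Q r)"
    using phint int by (simp add: \<phi>_def)
  also have "\<dots> \<le> (\<integral>y. h y / c - 1 + ln c \<partial>density Q r)"
  proof (rule integral_mono_AE)
    show "integrable (density Q r) (\<lambda>y. \<phi> y - ln (enn2real (r y)))" using phint int by auto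
    show "integrable (density Q r) (\<lambda>y. h y / c - 1 + ln c)" using hint by auto
    show "AE y in density Q r. \<phi> y - ln (enn2real (r y)) \<le> h y / c - 1 + ln c"
      using fin pos
    proof eventually_elim
      case (elim y)
      have rp: "enn2real (r y) > 0" using elim
        by (simp add: enn2real_positive_iff zero_less_iff_neq_zero top.not_eq_extremum)
      then have "h y / c > 0" using c by (simp add: h_def)
      then have "ln (h y / c) \<le> h y / c - 1" by (rule ln_le_minus_one)
      moreover have "ln (h y / c) = \<phi> y - ln (enn2real (r y)) - ln c"
        using rp c by (simp add: h_def ln_div ln_mult)
      ultimately show ?case by simp
    qed
  qed
  also have "\<dots> = (\<integral>y. h y \<partial>density Q r) / c - 1 + ln c"
    using hint P.prob_space by (simp del: space_density)
  also have "\<dots> \<le> ln c" using hle c by (simp add: field_simps)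
  finally show ?thesis using le unfolding c_def by linarith
qed

lemma PiM_density:
  fixes M :: "'i \<Rightarrow> 'a measure" and r :: "'i \<Rightarrow> 'a \<Rightarrow> ennreal"
  assumes I: "finite I" and M: "\<And>i. prob_space (M i)" and D: "\<And>i. prob_space (density (M i) (r i))"
    and r[measurable]: "\<And>i. r i \<in> borel_measurable (M i)"
  shows "PiM I (\<lambda>i. density (M i) (r i)) = density (PiM I M) (\<lambda>y. \<Prod>i\<in>I. r i (y i))"
proof -
  interpret M: product_prob_space M I
    using M by (intro product_prob_spaceI)
  interpret D: product_prob_space "\<lambda>i. density (M i) (r i)" I
    using D by (intro product_prob_spaceI)
  have "density (PiM I M) (\<lambda>y. \<Prod>i\<in>I. r i (y i)) = PiM I (\<lambda>i. density (M i) (r i))"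
  proof (rule D.PiM_eqI)
    show "sets (density (PiM I M) (\<lambda>y. \<Prod>i\<in>I. r i (y i))) = sets (PiM I (\<lambda>i. density (M i) (r i)))"
      by (auto intro!: sets_PiM_cong)
    fix A assume A: "\<And>i. i \<in> I \<Longrightarrow> A i \<in> sets (density (M i) (r i))"
    then have [measurable]: "\<And>i. i \<in> I \<Longrightarrow> A i \<in> sets (M i)" by simp
    have "emeasure (density (PiM I M) (\<lambda>y. \<Prod>i\<in>I. r i (y i))) (Pi\<^sub>E I A)
      = (\<integral>\<^sup>+ y. (\<Prod>i\<in>I. r i (y i)) * indicator (Pi\<^sub>E I A) y \<partial>PiM I M)"
      using I by (subst emeasure_density) (auto intro!: sets_PiM_I_finite)
    also have "\<dots> = (\<integral>\<^sup>+ y. (\<Prod>i\<in>I. r i (y i) * indicator (A i) (y i)) \<partial>PiM I M)"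
      by (intro nn_integral_cong)
        (use I in \<open>auto simp: prod.distrib indicator_def space_PiM PiE_iff\<close>)
    also have "\<dots> = (\<Prod>i\<in>I. \<integral>\<^sup>+ y. r i y * indicator (A i) y \<partial>M i)"
      by (rule M.product_nn_integral_prod) (use I in auto)
    also have "\<dots> = (\<Prod>i\<in>I. emeasure (density (M i) (r i)) (A i))"
      by (intro prod.cong refl) (simp add: emeasure_density)
    finally show "emeasure (density (PiM I M) (\<lambda>y. \<Prod>i\<in>I. r i (y i))) (Pi\<^sub>E I A)
      = (\<Prod>i\<in>I. emeasure (density (M i) (r i)) (A i))" .
  qed fact
  then show ?thesis by simp
qed

text \<open>
  For product measures the log-density is a sum over the coordinates, so its mean, the divergence, is
  the sum of the divergences of the factors.
\<close>

lemma PiM_event_change_of_measure: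
  fixes P Q :: "'i \<Rightarrow> 'a measure"
  assumes I: "finite I" and P: "\<And>i. prob_space (P i)" and Q: "\<And>i. prob_space (Q i)"
    and s: "\<And>i. sets (P i) = sets (Q i)"
    and kl: "\<And>i. i \<in> I \<Longrightarrow> kl_div (P i) (Q i) \<le> ereal (K i)"
    and A: "A \<in> sets (PiM I Q)" and lam: "0 \<le> lam"
  shows "lam * measure (PiM I P) A \<le> (\<Sum>i\<in>I. K i) + ln (1 + (exp lam - 1) * measure (PiM I Q) A)"
proof -
  \<comment> \<open>Product measures need a family defined for all indices; outside \<open>I\<close> the trivial density is used.\<close>
  define P' where "P' = (\<lambda>i. if i \<in> I then P i else Q i)"
  define r where "r = (\<lambda>i. RN_deriv (Q i) (P' i))"
  have [measurable]: "\<And>i. r i \<in> borel_measurable (Q i)" by (simp add: r_def)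
  have klI: "absolutely_continuous (Q i) (P i)" "integrable (P i) (entropy_density (exp 1) (Q i) (P i))"
    "KL_divergence (exp 1) (Q i) (P i) \<le> K i" if "i \<in> I" for i
    using kl[OF that] by (auto simp: kl_div_def split: if_splits)
  have d: "density (Q i) (r i) = P' i" for i
  proof -
    interpret prob_space "Q i" by (rule Q)
    have "absolutely_continuous (Q i) (P' i)" using klI(1)
      by (auto simp: P'_def absolutely_continuous_def)
    then show ?thesis unfolding r_def by (intro density_RN_deriv) (auto simp: P'_def s)
  qed
  have P': "prob_space (P' i)" for i using P Q by (auto simp: P'_def)
  have fin: "AE y in P i. r i y \<noteq> \<top>" if "i \<in> I" for i
  proof -
    interpret Q: prob_space "Q i" by (rule Q)
    interpret P: prob_space "P i" by (rule P)
    have "AE y in Q i. r i y \<noteq> \<infinity>" unfolding r_def using that klI(1)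
      by (intro Q.RN_deriv_finite) (auto simp: P'_def s intro: P.sigma_finite_measure_axioms)
    then show ?thesis using klI(1)[OF that] s by (intro absolutely_continuous_AE[of "P i" "Q i"]) auto
  qed
  have pos: "AE y in P i. r i y \<noteq> 0" if "i \<in> I" for i
  proof -
    have "AE y in density (Q i) (r i). r i y \<noteq> 0" by (subst AE_density) auto
    moreover have "density (Q i) (r i) = P i" using d that by (simp add: P'_def)
    ultimately show ?thesis by argo
  qed
  have lnr: "ln (enn2real (r i y)) = entropy_density (exp 1) (Q i) (P i) y" if "i \<in> I" for i y
    using that by (simp add: entropy_density_def r_def P'_def log_def)
  have PP: "PiM I P = density (PiM I Q) (\<lambda>y. \<Prod>i\<in>I. r i (y i))"
  proof -
    have "PiM I P = PiM I (\<lambda>i. density (Q i) (r i))"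
      unfolding d by (intro PiM_cong) (auto simp: P'_def)
    also have "\<dots> = density (PiM I Q) (\<lambda>y. \<Prod>i\<in>I. r i (y i))"
      by (rule PiM_density[OF I Q]) (use d P' in auto)
    finally show ?thesis .
  qed
  have PQ: "prob_space (PiM I Q)" "prob_space (PiM I P)" using P Q by (auto intro!: prob_space_PiM)
  have finI: "AE y in PiM I P. \<forall>i\<in>I. r i (y i) \<noteq> \<top>"
    using I by (intro AE_finite_allI AE_PiM_component[where M=P]) (use P fin in auto)
  have posI: "AE y in PiM I P. \<forall>i\<in>I. r i (y i) \<noteq> 0"
    using I by (intro AE_finite_allI AE_PiM_component[where M=P]) (use P pos in auto)
  let ?R = "\<lambda>y. \<Prod>i\<in>I. r i (y i)"
  have ae: "AE y in PiM I P. ?R y \<noteq> \<top> \<and> ln (enn2real (?R y)) = (\<Sum>i\<in>I. entropy_density (exp 1) (Q i) (P i) (y i))"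
    using finI posI
  proof eventually_elim
    case (elim y)
    define t where "t = (\<lambda>i. enn2real (r i (y i)))"
    have t: "r i (y i) = ennreal (t i)" "t i > 0" if "i \<in> I" for i
      using elim that unfolding t_def
      by (auto simp: enn2real_positive_iff zero_less_iff_neq_zero top.not_eq_extremum)
    have R: "?R y = ennreal (\<Prod>i\<in>I. t i)"
      using t by (subst prod_ennreal[symmetric]) (auto intro: less_imp_le)
    have "ln (enn2real (?R y)) = ln (\<Prod>i\<in>I. t i)"
      unfolding R using t by (subst enn2real_ennreal) (auto intro!: prod_pos less_imp_le)
    also have "\<dots> = (\<Sum>i\<in>I. ln (t i))" using I t(2)[THEN less_imp_neq, symmetric] by (intro ln_prod) blast+
    also have "\<dots> = (\<Sum>i\<in>I. entropy_density (exp 1) (Q i) (P i) (y i))"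
      by (intro sum.cong) (auto simp: t_def lnr)
    finally show ?case using R by simp
  qed
  have comp: "integrable (PiM I P) (\<lambda>y. entropy_density (exp 1) (Q i) (P i) (y i))"
    "(\<integral>y. entropy_density (exp 1) (Q i) (P i) (y i) \<partial>PiM I P) = KL_divergence (exp 1) (Q i) (P i)"
    if i: "i \<in> I" for i
  proof -
    have e: "distr (PiM I P) (P i) (\<lambda>\<omega>. \<omega> i) = P i" by (rule distr_PiM_component[OF P i])
    have m: "(\<lambda>\<omega>. \<omega> i) \<in> measurable (PiM I P) (P i)" using i by simp
    have m2: "entropy_density (exp 1) (Q i) (P i) \<in> borel_measurable (P i)"
      using klI(2)[OF i] by auto
    show "integrable (PiM I P) (\<lambda>y. entropy_density (exp 1) (Q i) (P i) (y i))"
      using klI(2)[OF i] integrable_distr_eq[OF m m2] e by simp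
    show "(\<integral>y. entropy_density (exp 1) (Q i) (P i) (y i) \<partial>PiM I P) = KL_divergence (exp 1) (Q i) (P i)"
      using integral_distr[OF m m2] e by (simp add: KL_divergence_def)
  qed
  have meas: "?R \<in> borel_measurable (PiM I P)" "?R \<in> borel_measurable (PiM I Q)"
    unfolding PP by measurable
  have "integrable (PiM I P) (\<lambda>y. \<Sum>i\<in>I. entropy_density (exp 1) (Q i) (P i) (y i))"
    using comp by auto
  then have int: "integrable (PiM I P) (\<lambda>y. ln (enn2real (?R y)))"
    by (rule Bochner_Integration.integrable_cong_AE_imp) (use meas ae in auto)
  have "(\<integral>y. ln (enn2real (?R y)) \<partial>PiM I P) = (\<integral>y. (\<Sum>i\<in>I. entropy_density (exp 1) (Q i) (P i) (y i)) \<partial>PiM I P)"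
    using int meas ae comp by (intro integral_cong_AE) auto
  also have "\<dots> = (\<Sum>i\<in>I. KL_divergence (exp 1) (Q i) (P i))" using comp by simp
  also have "\<dots> \<le> (\<Sum>i\<in>I. K i)" by (intro sum_mono klI)
  finally have le: "(\<integral>y. ln (enn2real (?R y)) \<partial>PiM I P) \<le> (\<Sum>i\<in>I. K i)" .
  have "AE y in PiM I P. ?R y \<noteq> \<top>" using ae by eventually_elim auto
  then show ?thesis using PQ meas(2) int le A lam unfolding PP
    by (intro event_change_of_measure)
qed

lemma obs_law_eq_PiM:
  assumes P: "prob_space P" and [simp]: "sets P = sets borel"
  shows "obs_law P n x f = PiM {1..n} (\<lambda>i. shift (f (x i)) P)"
proof -
  have [measurable_cong]: "sets P = sets borel" by simp
  show ?thesis
    unfolding obs_law_def shift_def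
  proof (rule product_sigma_finite.PiM_eqI)
    have pr: "prob_space (distr P borel (\<lambda>t. f (x i) + t))" for i
      using P by (intro prob_space.prob_space_distr) auto
    show "product_sigma_finite (\<lambda>i. distr P borel (\<lambda>t. f (x i) + t))"
      unfolding product_sigma_finite_def using pr prob_space_imp_sigma_finite by blast
    show "sets (distr (Pi\<^sub>M {1..n} (\<lambda>i. P)) (Pi\<^sub>M {1..n} (\<lambda>i. borel)) (\<lambda>\<epsilon>. \<lambda>i\<in>{1..n}. f (x i) + \<epsilon> i))
      = sets (Pi\<^sub>M {1..n} (\<lambda>i. distr P borel (\<lambda>t. f (x i) + t)))"
      by (simp cong: sets_PiM_cong)
    fix A :: "nat \<Rightarrow> real set"
    assume "\<And>i. i \<in> {1..n} \<Longrightarrow> A i \<in> sets (distr P borel (\<lambda>t. f (x i) + t))"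
    then have A: "\<And>i. i \<in> {1..n} \<Longrightarrow> A i \<in> sets borel" by simp
    interpret PP: product_prob_space "\<lambda>i. P" "{1..n}" using P by (intro product_prob_spaceI)
    have sp: "space P = UNIV" using sets_eq_imp_space_eq[of P borel] by simp
    have "emeasure (distr (Pi\<^sub>M {1..n} (\<lambda>i. P)) (Pi\<^sub>M {1..n} (\<lambda>i. borel)) (\<lambda>\<epsilon>. \<lambda>i\<in>{1..n}. f (x i) + \<epsilon> i)) (Pi\<^sub>E {1..n} A)
      = emeasure (Pi\<^sub>M {1..n} (\<lambda>i. P)) (Pi\<^sub>E {1..n} (\<lambda>i. (\<lambda>t. f (x i) + t) -` A i))"
      using A by (subst emeasure_distr)
        (auto intro!: arg_cong[where f="emeasure _"] sets_PiM_I_finite simp: space_PiM PiE_iff sp)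
    also have "\<dots> = (\<Prod>i\<in>{1..n}. emeasure P ((\<lambda>t. f (x i) + t) -` A i))"
      using A by (intro PP.emeasure_PiM) (auto intro!: measurable_sets_borel[of _ borel])
    also have "\<dots> = (\<Prod>i\<in>{1..n}. emeasure (distr P borel (\<lambda>t. f (x i) + t)) (A i))"
      using A by (intro prod.cong refl) (subst emeasure_distr, auto simp: sp)
    finally show "emeasure (distr (Pi\<^sub>M {1..n} (\<lambda>i. P)) (Pi\<^sub>M {1..n} (\<lambda>i. borel)) (\<lambda>\<epsilon>. \<lambda>i\<in>{1..n}. f (x i) + \<epsilon> i)) (Pi\<^sub>E {1..n} A)
      = (\<Prod>i\<in>{1..n}. emeasure (distr P borel (\<lambda>t. f (x i) + t)) (A i))" .
  qed simp
qed

lemma obs_law_event_change_of_measure: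
  assumes P: "prob_space P" "sets P = sets borel" and nc: "noise_cond C P"
    and A: "A \<in> sets (PiM {1..n} (\<lambda>i. borel :: real measure))" and lam: "0 \<le> lam"
  shows "lam * measure (obs_law P n x f) A \<le> (\<Sum>i\<in>{1..n}. C * \<bar>f (x i) - g (x i)\<bar>\<^sup>2)
    + ln (1 + (exp lam - 1) * measure (obs_law P n x g) A)"
  unfolding obs_law_eq_PiM[OF P]
proof (rule PiM_event_change_of_measure)
  have [measurable_cong]: "sets P = sets borel" using P by simp
  show "prob_space (shift (f (x i)) P)" "prob_space (shift (g (x i)) P)" for i
    unfolding shift_def using P by (auto intro!: prob_space.prob_space_distr)
  show "kl_div (shift (f (x i)) P) (shift (g (x i)) P) \<le> ereal (C * \<bar>f (x i) - g (x i)\<bar>\<^sup>2)" for i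
    using nc by (simp add: noise_cond_def)
  show "A \<in> sets (Pi\<^sub>M {1..n} (\<lambda>i. shift (g (x i)) P))"
    using A by (simp add: shift_def cong: sets_PiM_cong)
qed (use lam in \<open>auto simp: shift_def\<close>)

section \<open>Finite testing problems\<close>

text \<open>
  This turns a statement about the outer measure of a possibly nonmeasurable bad event into a
  measurable good event.
\<close>

lemma small_outer_measure_cover:
  assumes P: "prob_space P" and s: "sets P = sets M" and small: "outer_measure_of P {y\<in>space M. E y} < ennreal c"
  obtains G where "G \<in> sets M" "measure P G > 1 - c" "\<And>y. y \<in> G \<Longrightarrow> \<not> E y"
proof -
  interpret P: prob_space P by fact
  have sp: "space P = space M" using s by (rule sets_eq_imp_space_eq)
  obtain B where B: "B \<in> sets P" "{y\<in>space M. E y} \<subseteq> B" "outer_measure_of P {y\<in>space M. E y} = emeasure P B"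
    using outer_measure_of_attain[of "{y\<in>space M. E y}" P] sp by auto
  have "P.prob B < c"
    using small B(3) by (simp add: P.emeasure_eq_measure ennreal_less_iff)
  then have "P.prob (space P - B) > 1 - c" using P.prob_compl[OF B(1)] by simp
  moreover have "space P - B \<in> sets M" using B(1) s by auto
  ultimately show thesis using B(2) sp by (intro that[of "space P - B"]) auto
qed

text \<open>
  The value \<open>\<tau> y\<close> is chosen from the finite set \<open>{t\<in>T. y \<in> G t}\<close>, if this is nonempty, and depends on \<open>y\<close> only
  through it.  Each of the finitely many possible sets is taken on a measurable event, hence \<open>\<tau>\<close> is measurable.
\<close>

lemma finite_measurable_selector:
  assumes T: "finite T" "T \<noteq> {}" and G: "\<And>t. t \<in> T \<Longrightarrow> G t \<in> sets M"
  obtains \<tau> where "\<And>U. {y\<in>space M. \<tau> y \<in> U} \<in> sets M" "\<And>y. \<tau> y \<in> T"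
    "\<And>t y. t \<in> T \<Longrightarrow> y \<in> G t \<Longrightarrow> y \<in> G (\<tau> y)"
proof -
  obtain t0 where t0: "t0 \<in> T" using T by auto
  define \<sigma> where "\<sigma> = (\<lambda>S. if S = {} then t0 else SOME t. t \<in> S)"
  define \<tau> where "\<tau> = (\<lambda>y. \<sigma> {t\<in>T. y \<in> G t})"
  have \<sigma>: "\<sigma> S \<in> S" if "S \<noteq> {}" for S
    using that unfolding \<sigma>_def by (auto intro: someI)
  have eq: "{y\<in>space M. \<tau> y \<in> U} =
     (\<Union>S\<in>{S\<in>Pow T. \<sigma> S \<in> U}. {y\<in>space M. \<forall>t\<in>T. y \<in> G t \<longleftrightarrow> t \<in> S})" (is "_ = ?R") for U
  proof (intro equalityI subsetI)
    fix y assume y: "y \<in> {y\<in>space M. \<tau> y \<in> U}"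
    then show "y \<in> ?R"
      by (intro UN_I[of "{t\<in>T. y \<in> G t}"]) (auto simp: \<tau>_def)
  next
    fix y assume "y \<in> ?R"
    then obtain S where S: "S \<subseteq> T" "\<sigma> S \<in> U" "y \<in> space M" "\<forall>t\<in>T. y \<in> G t \<longleftrightarrow> t \<in> S" by auto
    then have "{t\<in>T. y \<in> G t} = S" by auto
    then show "y \<in> {y\<in>space M. \<tau> y \<in> U}" using S by (simp add: \<tau>_def)
  qed
  have m: "{y\<in>space M. \<forall>t\<in>T. y \<in> G t \<longleftrightarrow> t \<in> S} \<in> sets M" for S
  proof -
    have "{y\<in>space M. y \<in> G t \<longleftrightarrow> t \<in> S} \<in> sets M" if "t \<in> T" for t
    proof -
      have "{y\<in>space M. y \<in> G t \<longleftrightarrow> t \<in> S} = (if t \<in> S then G t else space M - G t)"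
        using sets.sets_into_space[OF G[OF that]] by auto
      then show ?thesis using G[OF that] by auto
    qed
    then show ?thesis using T by (intro sets.sets_Collect_finite_All) auto
  qed
  show thesis
  proof (rule that[of \<tau>])
    show "{y\<in>space M. \<tau> y \<in> U} \<in> sets M" for U
      unfolding eq using T m by (intro sets.finite_UN) auto
    show "\<tau> y \<in> T" for y
      using \<sigma>[of "{t\<in>T. y \<in> G t}"] t0 by (cases "{t\<in>T. y \<in> G t} = {}") (auto simp: \<tau>_def \<sigma>_def)
    show "y \<in> G (\<tau> y)" if "t \<in> T" "y \<in> G t" for t y
      using \<sigma>[of "{t\<in>T. y \<in> G t}"] that unfolding \<tau>_def by blast
  qed
qed

lemma sum_Pow_insert_pairs:
  fixes F :: "'j set \<Rightarrow> real"
  assumes "finite J" "j \<in> J"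
  shows "(\<Sum>w\<in>Pow J. F w) = (\<Sum>w\<in>Pow (J - {j}). F w + F (insert j w))"
proof -
  have J: "J = insert j (J - {j})" using assms by auto
  have "(\<Sum>w\<in>Pow J. F w) = (\<Sum>w\<in>Pow (J - {j}) \<union> insert j ` Pow (J - {j}). F w)"
    by (subst J, subst Pow_insert) simp
  also have "\<dots> = (\<Sum>w\<in>Pow (J - {j}). F w) + (\<Sum>w\<in>insert j ` Pow (J - {j}). F w)"
    using assms by (intro sum.union_disjoint) auto
  also have "(\<Sum>w\<in>insert j ` Pow (J - {j}). F w) = (\<Sum>w\<in>Pow (J - {j}). F (insert j w))"
    by (subst sum.reindex) (auto simp: inj_on_def)
  finally show ?thesis by (simp add: sum.distrib)
qed

text \<open>
  The hypotheses are the subsets \<open>w\<close> of \<open>J\<close>, and \<open>E w y\<close> says that the loss under \<open>w\<close> is large for the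
  data \<open>y\<close>.  If all large-loss probabilities were below 1/4, then with probability above 3/4 the measurable
  choice \<open>\<tau> y\<close> would have a small loss too, and by separation it would differ from \<open>w\<close> in at most 3/16 of
  the members of \<open>J\<close>.  So the mean number of misjudged members would be less than
  \<open>(3/16 + (1 - 3/16) / 4) * card J < 7/16 * card J\<close> for every \<open>w\<close>.  On the other hand, by closeness, the two error
  probabilities in deciding on one member of \<open>J\<close> add up to at least \<open>1 - 1/8\<close>, so that the average over all \<open>w\<close>
  of the mean number of misjudged members is at least \<open>7/16 * card J\<close>.
\<close>

lemma assouad:
  fixes P :: "'j set \<Rightarrow> 'a measure"
  assumes J: "finite J" "J \<noteq> {}"
    and P: "\<And>w. w \<subseteq> J \<Longrightarrow> prob_space (P w)" and s: "\<And>w. w \<subseteq> J \<Longrightarrow> sets (P w) = sets M"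
    and close: "\<And>j w A. j \<in> J \<Longrightarrow> w \<subseteq> J - {j} \<Longrightarrow> A \<in> sets M \<Longrightarrow>
      measure (P (insert j w)) A - measure (P w) A \<le> 1/8"
    and sep: "\<And>w w' y. w \<subseteq> J \<Longrightarrow> w' \<subseteq> J \<Longrightarrow> y \<in> space M \<Longrightarrow> \<not> E w y \<Longrightarrow> \<not> E w' y \<Longrightarrow>
      16 * real (card ((w - w') \<union> (w' - w))) < 3 * real (card J)"
  shows "\<exists>w\<subseteq>J. outer_measure_of (P w) {y\<in>space M. E w y} \<ge> ennreal (1/4)"
proof (rule ccontr)
  assume neg: "\<not> ?thesis"
  have "\<exists>G. G \<in> sets M \<and> measure (P w) G > 3/4 \<and> (\<forall>y\<in>G. \<not> E w y)" if "w \<in> Pow J" for w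
  proof -
    have w: "w \<subseteq> J" using that by simp
    obtain G where "G \<in> sets M" "measure (P w) G > 1 - 1/4" "\<And>y. y \<in> G \<Longrightarrow> \<not> E w y"
      using small_outer_measure_cover[OF P[OF w] s[OF w], of "E w" "1/4"] neg w by (auto simp: not_le)
    then show ?thesis by auto
  qed
  then obtain G where G: "\<And>w. w \<in> Pow J \<Longrightarrow> G w \<in> sets M" "\<And>w. w \<in> Pow J \<Longrightarrow> measure (P w) (G w) > 3/4"
    "\<And>w y. w \<in> Pow J \<Longrightarrow> y \<in> G w \<Longrightarrow> \<not> E w y"
    by metis
  obtain \<tau> where \<tau>m: "\<And>U. {y\<in>space M. \<tau> y \<in> U} \<in> sets M" and \<tau>J: "\<And>y. \<tau> y \<in> Pow J"
    and \<tau>G: "\<And>w y. w \<in> Pow J \<Longrightarrow> y \<in> G w \<Longrightarrow> y \<in> G (\<tau> y)"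
    by (rule finite_measurable_selector[of "Pow J" G M]) (use J G(1) in auto)
  define m where "m = real (card J)"
  have m: "m > 0" using J by (simp add: m_def card_gt_0_iff)
  define H where "H = (\<lambda>w y. (w - \<tau> y) \<union> (\<tau> y - w))"
  define B where "B = (\<lambda>j. {y\<in>space M. j \<in> \<tau> y})"
  have Bm: "B j \<in> sets M" for j using \<tau>m[of "{w. j \<in> w}"] by (simp add: B_def)
  define err where "err = (\<lambda>w j. if j \<in> w then space M - B j else B j)"
  have errm: "err w j \<in> sets M" for w j using Bm by (auto simp: err_def)
  \<comment> \<open>The number of misjudged members is at most \<open>m\<close> everywhere and at most \<open>3/16 * m\<close> on \<open>G w\<close>.\<close>
  have upper: "(\<Sum>j\<in>J. measure (P w) (err w j)) < 7/16 * m" if w: "w \<in> Pow J" for w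
  proof -
    interpret P: prob_space "P w" using P w by simp
    have sP: "sets (P w) = sets M" using s w by simp
    have spP: "space (P w) = space M" using sP by (rule sets_eq_imp_space_eq)
    have sumind: "(\<Sum>j\<in>J. indicator (err w j) y) = real (card (H w y))" if "y \<in> space M" for y
    proof -
      have "(\<Sum>j\<in>J. indicator (err w j) y) = (\<Sum>j\<in>J. if j \<in> H w y then 1 else 0 :: real)"
        using that by (intro sum.cong refl) (auto simp: err_def B_def H_def indicator_def)
      also have "\<dots> = real (card (J \<inter> H w y))" using J by (simp add: sum.If_cases Int_def)
      also have "J \<inter> H w y = H w y" using w \<tau>J[of y] by (auto simp: H_def)
      finally show ?thesis .
    qed
    have Gw: "G w \<in> P.events" using G(1)[OF w] sP by simp
    have "(\<Sum>j\<in>J. measure (P w) (err w j)) = (\<integral>y. (\<Sum>j\<in>J. indicator (err w j) y) \<partial>P w)"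
      using errm sP by (subst Bochner_Integration.integral_sum)
        (auto simp: P.emeasure_eq_measure Int_absorb1 sets.sets_into_space)
    also have "\<dots> \<le> (\<integral>y. m - 13/16 * m * indicator (G w) y \<partial>P w)"
    proof (rule integral_mono)
      show "integrable (P w) (\<lambda>y. \<Sum>j\<in>J. indicator (err w j) y :: real)"
        using errm sP by (auto simp: P.emeasure_eq_measure)
      show "integrable (P w) (\<lambda>y. m - 13/16 * m * indicator (G w) y)"
        using Gw by (auto simp: P.emeasure_eq_measure)
      fix y assume "y \<in> space (P w)"
      then have y: "y \<in> space M" using spP by simp
      have Hm: "real (card (H w y)) \<le> m" unfolding m_def
        using w \<tau>J[of y] J by (intro of_nat_mono card_mono) (auto simp: H_def)
      have "real (card (H w y)) \<le> 3/16 * m" if "y \<in> G w"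
        using sep[of w "\<tau> y" y] G(3)[OF w that] G(3)[OF \<tau>J \<tau>G[OF w that]] w \<tau>J[of y] y
        by (auto simp: H_def m_def)
      with Hm show "(\<Sum>j\<in>J. indicator (err w j) y) \<le> m - 13/16 * m * indicator (G w) y"
        unfolding sumind[OF y] by (auto split: split_indicator)
    qed
    also have "\<dots> = m - 13/16 * m * measure (P w) (G w)"
      using Gw by (simp add: P.prob_space P.emeasure_eq_measure Int_absorb1 sets.sets_into_space)
    \<comment> \<open>The value 9/13 solves \<open>1 - 13/16 * u = 7/16\<close> and lies below 3/4.\<close>
    also have "\<dots> < m - 13/16 * m * (9/13)"
      using G(2)[OF w] m by (simp add: field_simps)
    finally show ?thesis by simp
  qed
  \<comment> \<open>The hypotheses are paired by adding the member \<open>j\<close>.\<close>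
  have lower: "(\<Sum>w\<in>Pow J. measure (P w) (err w j)) \<ge> 7/16 * 2 ^ card J" if j: "j \<in> J" for j
  proof -
    have "(\<Sum>w\<in>Pow J. measure (P w) (err w j)) =
      (\<Sum>w\<in>Pow (J - {j}). measure (P w) (err w j) + measure (P (insert j w)) (err (insert j w) j))"
      by (rule sum_Pow_insert_pairs[OF J(1) j])
    also have "\<dots> \<ge> (\<Sum>w\<in>Pow (J - {j}). 7/8)"
    proof (rule sum_mono)
      fix w assume w: "w \<in> Pow (J - {j})"
      then have iw: "insert j w \<subseteq> J" "j \<notin> w" using j by auto
      interpret P: prob_space "P (insert j w)" using P iw by simp
      have sP: "sets (P (insert j w)) = sets M" using s iw by simp
      have spP: "space (P (insert j w)) = space M" using sP by (rule sets_eq_imp_space_eq)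
      have "measure (P (insert j w)) (space M - B j) = 1 - measure (P (insert j w)) (B j)"
        using P.prob_compl[of "B j"] Bm sP spP by simp
      then show "7/8 \<le> measure (P w) (err w j) + measure (P (insert j w)) (err (insert j w) j)"
        using close[OF j _ Bm, of w j] w iw by (simp add: err_def)
    qed
    also have "(\<Sum>w\<in>Pow (J - {j}). 7/8 :: real) = 7/16 * 2 ^ card J"
    proof -
      have "(2::real) ^ card J = 2 * 2 ^ card (J - {j})"
        unfolding card.remove[OF J(1) j] by (rule power_Suc)
      moreover have "(\<Sum>w\<in>Pow (J - {j}). 7/8 :: real) = 7/8 * 2 ^ card (J - {j})"
        using J(1) by (subst sum_constant, subst card_Pow) auto
      ultimately show ?thesis by linarith
    qed
    finally show ?thesis by simp
  qed
  have "7/16 * 2 ^ card J * m = (\<Sum>j\<in>J. 7/16 * 2 ^ card J)" by (simp add: m_def)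
  also have "\<dots> \<le> (\<Sum>j\<in>J. \<Sum>w\<in>Pow J. measure (P w) (err w j))" by (intro sum_mono lower)
  also have "\<dots> = (\<Sum>w\<in>Pow J. \<Sum>j\<in>J. measure (P w) (err w j))" by (rule sum.swap)
  also have "\<dots> < (\<Sum>w\<in>Pow J. 7/16 * m)"
    using J by (intro sum_strict_mono upper) auto
  also have "\<dots> = 7/16 * 2 ^ card J * m" using J by (simp add: card_Pow)
  finally show False by simp
qed

text \<open>
  Here the losses of two hypotheses are never both small, so the small-loss events are disjoint and one of
  them, \<open>G j\<close>, has \<open>Q\<close>-probability at most \<open>1 / card J\<close>.  The change of measure from \<open>Q\<close> to \<open>P j\<close> with
  \<open>lam = ln (card J)\<close> shows that the probability of \<open>G j\<close> under \<open>P j\<close> cannot exceed 3/4.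
\<close>

lemma fano:
  fixes P :: "'j \<Rightarrow> 'a measure"
  assumes J: "finite J" "J \<noteq> {}"
    and P: "\<And>j. j \<in> J \<Longrightarrow> prob_space (P j)" and s: "\<And>j. j \<in> J \<Longrightarrow> sets (P j) = sets M"
    and Q: "prob_space Q" "sets Q = sets M"
    and kl: "\<And>j A lam. j \<in> J \<Longrightarrow> A \<in> sets M \<Longrightarrow> 0 \<le> lam \<Longrightarrow>
      lam * measure (P j) A \<le> K + ln (1 + (exp lam - 1) * measure Q A)"
    and K: "K + ln 2 \<le> 3/4 * ln (real (card J))"
    and sep: "\<And>j j' y. j \<in> J \<Longrightarrow> j' \<in> J \<Longrightarrow> y \<in> space M \<Longrightarrow> \<not> E j y \<Longrightarrow> \<not> E j' y \<Longrightarrow> j = j'"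
  shows "\<exists>j\<in>J. outer_measure_of (P j) {y\<in>space M. E j y} \<ge> ennreal (1/4)"
proof (rule ccontr)
  assume neg: "\<not> ?thesis"
  interpret Q: prob_space Q by fact
  have "\<exists>G. G \<in> sets M \<and> measure (P j) G > 3/4 \<and> (\<forall>y\<in>G. \<not> E j y)" if j: "j \<in> J" for j
  proof -
    obtain G where "G \<in> sets M" "measure (P j) G > 1 - 1/4" "\<And>y. y \<in> G \<Longrightarrow> \<not> E j y"
      using small_outer_measure_cover[OF P[OF j] s[OF j], of "E j" "1/4"] neg j by (auto simp: not_le)
    then show ?thesis by auto
  qed
  then obtain G where G: "\<And>j. j \<in> J \<Longrightarrow> G j \<in> sets M" "\<And>j. j \<in> J \<Longrightarrow> measure (P j) (G j) > 3/4"
    "\<And>j y. j \<in> J \<Longrightarrow> y \<in> G j \<Longrightarrow> \<not> E j y"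
    by metis
  have disj: "disjoint_family_on G J"
    unfolding disjoint_family_on_def using sep G(3) G(1)[THEN sets.sets_into_space] by blast
  define m where "m = real (card J)"
  have m: "m \<ge> 1" using J by (simp add: m_def Suc_leI card_gt_0_iff)
  have "\<exists>j\<in>J. Q.prob (G j) \<le> 1 / m"
  proof (rule ccontr)
    assume "\<not> (\<exists>j\<in>J. Q.prob (G j) \<le> 1 / m)"
    then have "(\<Sum>j\<in>J. 1 / m) < (\<Sum>j\<in>J. Q.prob (G j))" using J by (intro sum_strict_mono) auto
    also have "\<dots> = Q.prob (\<Union>j\<in>J. G j)"
      using J disj G(1) Q(2) by (intro Q.finite_measure_finite_Union[symmetric]) auto
    also have "\<dots> \<le> 1" by (rule Q.prob_le_1)
    finally show False using m by (simp add: m_def)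
  qed
  then obtain j where j: "j \<in> J" "Q.prob (G j) \<le> 1 / m" by auto
  have "ln m * measure (P j) (G j) \<le> K + ln (1 + (exp (ln m) - 1) * Q.prob (G j))"
    using m by (intro kl j G(1)) auto
  also have "\<dots> \<le> K + ln 2"
  proof -
    have "(m - 1) * Q.prob (G j) \<le> (m - 1) * (1 / m)" using j m by (intro mult_left_mono) auto
    also have "\<dots> \<le> 1" using m by (simp add: field_simps)
    finally show ?thesis using m by (simp add: add_pos_nonneg)
  qed
  also have "\<dots> \<le> ln m * (3/4)" using K by (simp add: m_def)
  finally have *: "ln m * measure (P j) (G j) \<le> ln m * (3/4)" .
  have "m > 1"
  proof -
    have "0 \<le> K" using kl[of j "{}" 0] j by simp
    moreover have "ln 2 > (0::real)" by simp
    ultimately have "ln m > 0" using K unfolding m_def by linarith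
    then show ?thesis using m by simp
  qed
  then show False using * G(2)[OF j(1)] by simp
qed

text \<open>
  For small \<open>lam\<close> the logarithm is at most about \<open>(lam + lam\<^sup>2) * b\<close>, so \<open>a - b\<close> is at most about
  \<open>K / lam + lam\<close>; the value \<open>lam = 1/16\<close> balances the two terms for \<open>K = 1/256\<close>.
\<close>

lemma total_variation_of_change_of_measure:
  fixes a b K :: real
  assumes "\<And>lam. 0 \<le> lam \<Longrightarrow> lam * a \<le> K + ln (1 + (exp lam - 1) * b)"
    and "0 \<le> b" "b \<le> 1" "K \<le> 1/256"
  shows "a - b \<le> 1/8"
proof -
  have e: "exp (1/16) \<le> (1 + 1/16 + (1/16)^2 :: real)" by (rule exp_bound) auto
  have "a / 16 \<le> K + ln (1 + (exp (1/16) - 1) * b)" using assms(1)[of "1/16"] by simp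
  also have "ln (1 + (exp (1/16) - 1) * b) \<le> (exp (1/16) - 1) * b"
    using assms(2) by (intro ln_add_one_self_le_self) auto
  also have "(exp (1/16) - 1) * b \<le> (1/16 + (1/16)^2) * b" using e assms(2) by (intro mult_right_mono) auto
  also have "\<dots> \<le> b / 16 + 1/256" using assms(3) by (simp add: power2_eq_square field_simps)
  finally show ?thesis using assms(4) by simp
qed

section \<open>Functions with bounded derivatives\<close>

text \<open>
  The function is \<open>k\<close> times differentiable, and for \<open>j \<le> k\<close> its \<open>j\<close>-th derivative in the directions
  \<open>v\<^sub>1, \<dots>, v\<^sub>j\<close> is at most \<open>B\<close> times the product of the norms.  The recursion removes the innermost direction
  of \<open>iter_deriv\<close>; carrying the factor \<open>norm v\<close> along makes the bound uniform in the directions and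
  stable under sums and products.
\<close>

primrec bounded_derivs :: "nat \<Rightarrow> real \<Rightarrow> ('a::euclidean_space \<Rightarrow> real) \<Rightarrow> bool" where
  "bounded_derivs 0 B f \<longleftrightarrow> (\<forall>x. \<bar>f x\<bar> \<le> B)"
| "bounded_derivs (Suc k) B f \<longleftrightarrow> (\<forall>x. \<bar>f x\<bar> \<le> B) \<and> (\<forall>x. f differentiable (at x)) \<and>
     (\<forall>v. bounded_derivs k (B * norm v) (\<lambda>x. frechet_derivative f (at x) v))"

lemma bounded_derivs_bound: "bounded_derivs k B f \<Longrightarrow> \<bar>f x\<bar> \<le> B"
  by (cases k) auto

lemma bounded_derivs_nonneg: "bounded_derivs k B f \<Longrightarrow> 0 \<le> B"
  using bounded_derivs_bound[of k B f undefined] by linarith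

lemma bounded_derivs_SucI:
  assumes "\<And>x. \<bar>f x\<bar> \<le> B" "\<And>x. (f has_derivative (\<lambda>v. D v x)) (at x)"
    "\<And>v. bounded_derivs k (B * norm v) (D v)"
  shows "bounded_derivs (Suc k) B f"
proof -
  have "(\<lambda>x. frechet_derivative f (at x) v) = D v" for v
    by (rule ext) (simp flip: frechet_derivative_at[OF assms(2)])
  then show ?thesis using assms by (auto simp: differentiable_def)
qed

lemma bounded_derivs_mono: "bounded_derivs k B f \<Longrightarrow> B \<le> B' \<Longrightarrow> bounded_derivs k B' f"
proof (induction k arbitrary: B B' f)
  case (Suc k)
  have "bounded_derivs k (B' * norm v) (\<lambda>x. frechet_derivative f (at x) v)" for v
    by (rule Suc.IH[of "B * norm v"]) (use Suc.prems in \<open>auto intro: mult_right_mono\<close>)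
  then show ?case using Suc.prems by (auto intro: order_trans)
qed (auto intro: order_trans)

lemma bounded_derivs_Suc_imp: "bounded_derivs (Suc k) B f \<Longrightarrow> bounded_derivs k B f"
  by (induction k arbitrary: B f) auto

lemma bounded_derivs_zero: "0 \<le> B \<Longrightarrow> bounded_derivs k B (\<lambda>x. 0)"
  by (induction k arbitrary: B) auto

lemma bounded_derivs_const: "\<bar>c\<bar> \<le> B \<Longrightarrow> bounded_derivs k B (\<lambda>x. c)"
  by (cases k) (auto intro: bounded_derivs_zero)

lemma bounded_derivs_add:
  "bounded_derivs k A f \<Longrightarrow> bounded_derivs k B g \<Longrightarrow> bounded_derivs k (A + B) (\<lambda>x. f x + g x)"
proof (induction k arbitrary: A B f g)
  case (Suc k)
  show ?case
  proof (rule bounded_derivs_SucI)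
    show "\<bar>f x + g x\<bar> \<le> A + B" for x
      using bounded_derivs_bound[OF Suc.prems(1), of x] bounded_derivs_bound[OF Suc.prems(2), of x] by linarith
    show "((\<lambda>x. f x + g x) has_derivative
       (\<lambda>v. frechet_derivative f (at x) v + frechet_derivative g (at x) v)) (at x)" for x
      using Suc.prems by (intro has_derivative_add) (auto simp: frechet_derivative_works)
    show "bounded_derivs k ((A + B) * norm v)
       (\<lambda>x. frechet_derivative f (at x) v + frechet_derivative g (at x) v)" for v
      unfolding distrib_right using Suc.prems by (intro Suc.IH) auto
  qed
qed (auto intro: order_trans[OF abs_triangle_ineq add_mono])

lemma bounded_derivs_cmult:
  "bounded_derivs k B f \<Longrightarrow> bounded_derivs k (\<bar>c\<bar> * B) (\<lambda>x. c * f x)"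
proof (induction k arbitrary: B f)
  case (Suc k)
  show ?case
  proof (rule bounded_derivs_SucI)
    show "\<bar>c * f x\<bar> \<le> \<bar>c\<bar> * B" for x
      using bounded_derivs_bound[OF Suc.prems, of x] by (simp add: abs_mult mult_left_mono)
    show "((\<lambda>x. c * f x) has_derivative (\<lambda>v. c * frechet_derivative f (at x) v)) (at x)" for x
      using Suc.prems by (intro has_derivative_mult_right) (auto simp: frechet_derivative_works)
    show "bounded_derivs k (\<bar>c\<bar> * B * norm v) (\<lambda>x. c * frechet_derivative f (at x) v)" for v
      unfolding mult.assoc using Suc.prems by (intro Suc.IH) auto
  qed
qed (auto simp: abs_mult intro: mult_left_mono)

lemma bounded_derivs_mult:
  "bounded_derivs k A f \<Longrightarrow> bounded_derivs k B g \<Longrightarrow> bounded_derivs k (2 ^ k * A * B) (\<lambda>x. f x * g x)"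
proof (induction k arbitrary: A B f g)
  case 0
  then show ?case using bounded_derivs_nonneg[of 0] by (auto simp: abs_mult intro!: mult_mono)
next
  case (Suc k)
  have nn: "0 \<le> A" "0 \<le> B" using Suc.prems bounded_derivs_nonneg by blast+
  show ?case
  proof (rule bounded_derivs_SucI)
    fix x
    have "\<bar>f x * g x\<bar> \<le> A * B" unfolding abs_mult
      using bounded_derivs_bound[OF Suc.prems(1), of x] bounded_derivs_bound[OF Suc.prems(2), of x] nn
      by (intro mult_mono) auto
    also have "\<dots> \<le> 2 ^ Suc k * (A * B)"
      using nn mult_right_mono[OF one_le_power[of "2::real" "Suc k"], of "A * B"] by simp
    finally show "\<bar>f x * g x\<bar> \<le> 2 ^ Suc k * A * B" by (simp add: mult.assoc)
    show "((\<lambda>x. f x * g x) has_derivative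
       (\<lambda>v. f x * frechet_derivative g (at x) v + frechet_derivative f (at x) v * g x)) (at x)"
      using Suc.prems by (intro has_derivative_mult) (auto simp: frechet_derivative_works)
  next
    fix v
    have "bounded_derivs k (2 ^ k * A * (B * norm v) + 2 ^ k * (A * norm v) * B)
       (\<lambda>x. f x * frechet_derivative g (at x) v + frechet_derivative f (at x) v * g x)"
      using Suc.prems Suc.prems[THEN bounded_derivs_Suc_imp]
      by (intro bounded_derivs_add Suc.IH) auto
    then show "bounded_derivs k (2 ^ Suc k * A * B * norm v)
       (\<lambda>x. f x * frechet_derivative g (at x) v + frechet_derivative f (at x) v * g x)"
      by (simp add: algebra_simps)
  qed
qed

lemma bounded_derivs_translate:
  "bounded_derivs k B f \<Longrightarrow> bounded_derivs k B (\<lambda>x. f (x + y))"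
proof (induction k arbitrary: B f)
  case (Suc k)
  show ?case
  proof (rule bounded_derivs_SucI)
    show "\<bar>f (x + y)\<bar> \<le> B" for x using Suc.prems by simp
    show "((\<lambda>x. f (x + y)) has_derivative (\<lambda>v. frechet_derivative f (at (x + y)) v)) (at x)" for x
    proof -
      have g: "((\<lambda>x. x + y) has_derivative (\<lambda>v. v)) (at x)" by (auto intro!: derivative_eq_intros)
      have f: "(f has_derivative frechet_derivative f (at (x + y))) (at (x + y))"
        using Suc.prems by (simp add: frechet_derivative_works)
      show ?thesis using has_derivative_compose[OF g f] by simp
    qed
    show "bounded_derivs k (B * norm v) (\<lambda>x. frechet_derivative f (at (x + y)) v)" for v
      by (rule Suc.IH) (use Suc.prems in simp)
  qed
qed simp

lemma iter_deriv_snoc: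
  "iter_deriv f (vs @ [w]) = iter_deriv (\<lambda>x. frechet_derivative f (at x) w) vs"
  by (induction vs) auto

lemma bounded_derivs_iter_deriv:
  assumes "bounded_derivs k B f" "length vs \<le> k" "\<And>v. v \<in> set vs \<Longrightarrow> norm v = 1"
  shows "bounded_derivs (k - length vs) B (iter_deriv f vs)"
  using assms
proof (induction vs arbitrary: f k rule: rev_induct)
  case (snoc w vs)
  then obtain k' where k: "k = Suc k'" by (cases k) auto
  have "norm w = 1" using snoc.prems(3) by simp
  moreover have "bounded_derivs k' (B * norm w) (\<lambda>x. frechet_derivative f (at x) w)"
    using snoc.prems(1) unfolding k by simp
  ultimately have "bounded_derivs k' B (\<lambda>x. frechet_derivative f (at x) w)" by simp
  then have "bounded_derivs (k' - length vs) B (iter_deriv (\<lambda>x. frechet_derivative f (at x) w) vs)"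
    using snoc.prems unfolding k by (intro snoc.IH) auto
  then show ?case by (simp only: k iter_deriv_snoc length_append_singleton diff_Suc_Suc)
qed auto

lemma iter_deriv_differentiable:
  assumes "bounded_derivs k B f" "length vs < k"
  shows "iter_deriv f vs differentiable (at x)"
  using assms
proof (induction vs arbitrary: f k B rule: rev_induct)
  case Nil
  then show ?case by (cases k) auto
next
  case (snoc w vs)
  then obtain k' where k: "k = Suc k'" by (cases k) auto
  show ?case unfolding iter_deriv_snoc
    by (rule snoc.IH[of k' "B * norm w"]) (use snoc.prems k in auto)
qed

lemma iter_deriv_bound:
  assumes "bounded_derivs k B f" "length vs \<le> k" "\<And>v. v \<in> set vs \<Longrightarrow> norm v = 1"
  shows "\<bar>iter_deriv f vs x\<bar> \<le> B"
  using bounded_derivs_bound[OF bounded_derivs_iter_deriv[OF assms]] by simp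

lemma iter_deriv_lipschitz:
  assumes f: "bounded_derivs k B f" "length vs < k" "\<And>v. v \<in> set vs \<Longrightarrow> norm v = 1"
  shows "\<bar>iter_deriv f vs x - iter_deriv f vs y\<bar> \<le> B * norm (x - y)"
proof -
  obtain m where m: "k - length vs = Suc m" using f(2) by (metis Suc_diff_Suc)
  have b: "bounded_derivs (Suc m) B (iter_deriv f vs)"
    using bounded_derivs_iter_deriv[OF f(1) less_imp_le[OF f(2)] f(3)] by (simp only: m)
  have "norm (iter_deriv f vs x - iter_deriv f vs y) \<le> B * norm (x - y)"
  proof (rule differentiable_bound)
    show "convex UNIV" by simp
    show "(iter_deriv f vs has_derivative frechet_derivative (iter_deriv f vs) (at x)) (at x within UNIV)" for x
      using b by (auto simp: frechet_derivative_works)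
    show "onorm (frechet_derivative (iter_deriv f vs) (at x)) \<le> B" for x
    proof (rule onorm_le)
      fix v
      have "bounded_derivs m (B * norm v) (\<lambda>x. frechet_derivative (iter_deriv f vs) (at x) v)"
        using b by simp
      from bounded_derivs_bound[OF this]
      show "norm (frechet_derivative (iter_deriv f vs) (at x) v) \<le> B * norm v" by simp
    qed
  qed auto
  then show ?thesis by simp
qed

lemma iter_deriv_sum_rescaled:
  fixes K :: "'a::euclidean_space \<Rightarrow> real"
  assumes K: "bounded_derivs k B K" and h: "h > 0"
  shows "length vs \<le> k \<Longrightarrow> iter_deriv (\<lambda>x. \<Sum>z\<in>J. a * K ((x - z) /\<^sub>R h)) vs =
     (\<lambda>x. \<Sum>z\<in>J. a * (inverse h ^ length vs * iter_deriv K vs ((x - z) /\<^sub>R h)))"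
proof (induction vs)
  case (Cons v vs)
  let ?F = "\<lambda>vs x. \<Sum>z\<in>J. a * (inverse h ^ length vs * iter_deriv K vs ((x - z) /\<^sub>R h))"
  have d: "(?F vs has_derivative (\<lambda>v. ?F (v # vs) x)) (at x)" for x
  proof -
    have "((\<lambda>x. iter_deriv K vs ((x - z) /\<^sub>R h)) has_derivative
        (\<lambda>v. frechet_derivative (iter_deriv K vs) (at ((x - z) /\<^sub>R h)) (v /\<^sub>R h))) (at x)" for z
    proof -
      have g: "((\<lambda>x. (x - z) /\<^sub>R h) has_derivative (\<lambda>v. v /\<^sub>R h)) (at x)"
        by (auto intro!: derivative_eq_intros)
      have "(iter_deriv K vs has_derivative frechet_derivative (iter_deriv K vs) (at ((x - z) /\<^sub>R h)))
          (at ((x - z) /\<^sub>R h))"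
        using iter_deriv_differentiable[OF K, of vs] Cons.prems by (simp add: frechet_derivative_works)
      from has_derivative_compose[OF g this] show ?thesis .
    qed
    moreover have "frechet_derivative (iter_deriv K vs) (at y) (v /\<^sub>R h) =
        inverse h * frechet_derivative (iter_deriv K vs) (at y) v" for y v
    proof -
      have "linear (frechet_derivative (iter_deriv K vs) (at y))"
        using iter_deriv_differentiable[OF K, of vs] Cons.prems by (intro linear_frechet_derivative) auto
      then show ?thesis by (simp add: linear_scale)
    qed
    ultimately have "((\<lambda>x. iter_deriv K vs ((x - z) /\<^sub>R h)) has_derivative
        (\<lambda>v. inverse h * frechet_derivative (iter_deriv K vs) (at ((x - z) /\<^sub>R h)) v)) (at x)" for z
      by simp
    then have "(?F vs has_derivative (\<lambda>v. \<Sum>z\<in>J. a * (inverse h ^ length vs *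
        (inverse h * frechet_derivative (iter_deriv K vs) (at ((x - z) /\<^sub>R h)) v)))) (at x)"
      by (intro has_derivative_sum has_derivative_mult_right)
    then show ?thesis by (simp add: mult_ac)
  qed
  have "frechet_derivative (?F vs) (at x) v = ?F (v # vs) x" for x
    using fun_cong[OF frechet_derivative_at[OF d], of v] by simp
  then show ?case using Cons by simp
qed simp

lemma iter_deriv_eq_0_outside:
  fixes f :: "'a::euclidean_space \<Rightarrow> real"
  assumes "\<And>x. norm x > r \<Longrightarrow> f x = 0"
  shows "norm x > r \<Longrightarrow> iter_deriv f vs x = 0"
proof (induction vs arbitrary: x)
  case (Cons v vs)
  have "open {x::'a. norm x > r}" by (intro open_Collect_less continuous_intros)
  then have "(iter_deriv f vs has_derivative (\<lambda>v. 0)) (at x)"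
    using Cons by (intro has_derivative_transform_within_open[OF has_derivative_const]) auto
  from fun_cong[OF frechet_derivative_at[OF this], of v] show ?case by simp
qed (use assms in auto)

text \<open>
  A line through \<open>x\<close> in the unit direction \<open>v\<close> has left the ball of radius \<open>r\<close> after the length
  \<open>2 * r + 1\<close>.  On this segment \<open>f\<close> falls from \<open>f x\<close> to 0.
\<close>

lemma directional_derivative_large:
  fixes f :: "'a::euclidean_space \<Rightarrow> real"
  assumes d: "\<And>x. f differentiable (at x)" and z: "\<And>x. norm x > r \<Longrightarrow> f x = 0"
    and v: "norm v = 1" and x: "norm x \<le> r"
  obtains y where "norm y \<le> r" "\<bar>frechet_derivative f (at y) v\<bar> \<ge> \<bar>f x\<bar> / (2 * r + 1)"
proof -
  have r: "r \<ge> 0" using x norm_ge_zero order_trans by blast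
  \<comment> \<open>The length of the segment; \<open>2 * r\<close> would only reach the boundary of the ball.\<close>
  define T where "T = 2 * r + 1"
  have T: "T > 0" using r by (simp add: T_def)
  define g where "g = (\<lambda>t. f (x + t *\<^sub>R v))"
  have g: "(g has_derivative (\<lambda>s. s * frechet_derivative f (at (x + t *\<^sub>R v)) v)) (at t)" for t
  proof -
    have a: "((\<lambda>t. x + t *\<^sub>R v) has_derivative (\<lambda>s. s *\<^sub>R v)) (at t)"
      by (auto intro!: derivative_eq_intros)
    have b: "(f has_derivative frechet_derivative f (at (x + t *\<^sub>R v))) (at (x + t *\<^sub>R v))"
      using d by (simp add: frechet_derivative_works)
    have "linear (frechet_derivative f (at (x + t *\<^sub>R v)))"
      using d by (rule linear_frechet_derivative)
    then show ?thesis unfolding g_def using has_derivative_compose[OF a b] by (simp add: linear_scale)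
  qed
  have "\<exists>t>0. t < T \<and> g T - g 0 = (T - 0) * frechet_derivative f (at (x + t *\<^sub>R v)) v"
    using T g by (intro MVT2) (auto simp: has_field_derivative_def mult_commute_abs)
  then obtain t where t: "g T - g 0 = T * frechet_derivative f (at (x + t *\<^sub>R v)) v" by auto
  have "norm (T *\<^sub>R v) \<le> norm (x + T *\<^sub>R v) + norm x" by (metis add_diff_cancel_left' norm_triangle_ineq4)
  then have "norm (x + T *\<^sub>R v) > r" using v x T by (simp add: T_def)
  then have "g T = 0" using z by (simp add: g_def)
  then have "- f x = T * frechet_derivative f (at (x + t *\<^sub>R v)) v"
    using t by (simp add: g_def)
  then have "\<bar>f x\<bar> = T * \<bar>frechet_derivative f (at (x + t *\<^sub>R v)) v\<bar>"
    using T by (metis abs_minus_cancel abs_mult abs_of_pos)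
  then have e: "\<bar>frechet_derivative f (at (x + t *\<^sub>R v)) v\<bar> = \<bar>f x\<bar> / (2 * r + 1)"
    using T by (simp add: T_def field_simps)
  show thesis
  proof (cases "norm (x + t *\<^sub>R v) \<le> r")
    case True
    then show ?thesis using e by (intro that) auto
  next
    case False
    then have "frechet_derivative f (at (x + t *\<^sub>R v)) v = 0"
      using iter_deriv_eq_0_outside[of r f "x + t *\<^sub>R v" "[v]"] z by simp
    then show ?thesis using e x by (intro that[of x]) auto
  qed
qed

lemma iter_deriv_large:
  fixes f :: "'a::euclidean_space \<Rightarrow> real"
  assumes f: "bounded_derivs k B f" and z: "\<And>x. norm x > r \<Longrightarrow> f x = 0" and r: "r \<ge> 0"
  shows "length vs \<le> k \<Longrightarrow> (\<And>v. v \<in> set vs \<Longrightarrow> norm v = 1) \<Longrightarrow>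
    \<exists>y. norm y \<le> r \<and> \<bar>iter_deriv f vs y\<bar> \<ge> \<bar>f 0\<bar> / (2 * r + 1) ^ length vs"
proof (induction vs)
  case Nil
  then show ?case using r by (intro exI[of _ 0]) auto
next
  case (Cons v vs)
  then obtain x where x: "norm x \<le> r" "\<bar>iter_deriv f vs x\<bar> \<ge> \<bar>f 0\<bar> / (2 * r + 1) ^ length vs" by auto
  obtain y where y: "norm y \<le> r"
    "\<bar>frechet_derivative (iter_deriv f vs) (at y) v\<bar> \<ge> \<bar>iter_deriv f vs x\<bar> / (2 * r + 1)"
    by (rule directional_derivative_large[of "iter_deriv f vs" r v x])
      (use Cons.prems x iter_deriv_differentiable[OF f, of vs] iter_deriv_eq_0_outside[of r f _ vs] z in auto)
  have "\<bar>f 0\<bar> / (2 * r + 1) ^ length (v # vs) = \<bar>f 0\<bar> / (2 * r + 1) ^ length vs / (2 * r + 1)"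
    by simp
  also have "\<dots> \<le> \<bar>iter_deriv f vs x\<bar> / (2 * r + 1)" using x r by (intro divide_right_mono) auto
  finally show ?case using y by (intro exI[of _ y]) auto
qed

section \<open>A bump function and its derivatives\<close>

lemma has_real_derivative_max_0_power:
  fixes y :: real
  assumes "n \<ge> 1"
  shows "((\<lambda>y. max 0 y ^ Suc n) has_real_derivative real (Suc n) * max 0 y ^ n) (at y)"
proof -
  consider "y > 0" | "y < 0" | "y = 0" by linarith
  then show ?thesis
  proof cases
    case 1
    have "((\<lambda>y. y ^ Suc n) has_real_derivative real (Suc n) * max 0 y ^ n) (at y)"
      using 1 DERIV_pow[of "Suc n" y] by (simp add: max_def)
    then show ?thesis
      by (rule has_field_derivative_transform_within_open[where S="{0<..}"]) (use 1 in auto)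
  next
    case 2
    have "((\<lambda>y. 0) has_real_derivative real (Suc n) * max 0 y ^ n) (at y)"
      using 2 assms by (auto simp: max_def power_0_left)
    then show ?thesis
      by (rule has_field_derivative_transform_within_open[where S="{..<0}"]) (use 2 in auto)
  next
    case 3
    have "(\<lambda>h::real. (max 0 (0 + h) ^ Suc n - max 0 0 ^ Suc n) / h) \<midarrow>0\<rightarrow> 0"
    proof (rule Lim_null_comparison)
      show "\<forall>\<^sub>F h::real in at 0. norm ((max 0 (0 + h) ^ Suc n - max 0 0 ^ Suc n) / h) \<le> \<bar>h\<bar> ^ n"
        by (intro always_eventually) (auto simp: max_def)
      have "((\<lambda>h::real. \<bar>h\<bar> ^ n) \<longlongrightarrow> \<bar>0\<bar> ^ n) (at 0)" by (intro tendsto_intros)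
      then show "((\<lambda>h::real. \<bar>h\<bar> ^ n) \<longlongrightarrow> 0) (at 0)" using assms by (simp add: power_0_left)
    qed
    then show ?thesis using 3 assms by (simp add: DERIV_def power_0_left)
  qed
qed

lemma coordinate_bump_le_1:
  fixes t :: real
  assumes "a \<ge> 1"
  shows "\<bar>t ^ b * max 0 (1 - t\<^sup>2) ^ a\<bar> \<le> 1"
  proof (cases "\<bar>t\<bar> \<le> 1")
    case True
    have "t\<^sup>2 \<le> 1" using True by (simp add: abs_square_le_1)
    then show ?thesis using True unfolding abs_mult power_abs
      by (intro mult_le_one power_le_one) auto
  next
    case False
    then have "t\<^sup>2 \<ge> 1" by (metis abs_square_le_1 linear)
    then show ?thesis using assms by (simp add: max_def power_0_left)
  qed

text \<open>
  The functions \<open>t ^ b * max 0 (1 - t\<^sup>2) ^ a\<close> are chosen because their derivatives stay within the family: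
  the derivative is \<open>b\<close> times the function with exponents \<open>b - 1\<close> and \<open>a\<close>,
  minus \<open>2 * a\<close> times the one with \<open>b + 1\<close> and \<open>a - 1\<close>.  The quantity \<open>b + 2 * a\<close> decreases for both of them
  and bounds the sum of the coefficients.
\<close>

lemma bounded_derivs_coordinate_bump:
  fixes i :: "'d::finite"
  shows "a \<ge> Suc k \<Longrightarrow> bounded_derivs k (real (b + 2 * a) ^ k)
    (\<lambda>x::real^'d. (x $ i) ^ b * max 0 (1 - (x $ i)\<^sup>2) ^ a)"
proof (induction k arbitrary: a b)
    case 0
    then show ?case using coordinate_bump_le_1 by simp
  next
    case (Suc k)
    define N where "N = real (b + 2 * a)"
    have N: "N \<ge> 1" using Suc.prems by (simp add: N_def)
    obtain c where c: "a = Suc c" "c \<ge> 1" "c \<ge> Suc k" using Suc.prems by (cases a) auto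
    let ?g = "\<lambda>b a t. t ^ b * max 0 (1 - t\<^sup>2) ^ a :: real"
    let ?D = "\<lambda>t. real b * ?g (b - 1) a t + (- 2 * real a) * ?g (b + 1) c t"
    have q: "((\<lambda>t. max 0 (1 - t\<^sup>2) ^ a) has_real_derivative (real a * max 0 (1 - t\<^sup>2) ^ c * (- 2 * t))) (at t)" for t
      unfolding c(1)
      by (rule DERIV_chain2[OF has_real_derivative_max_0_power[OF c(2)]]) (auto intro!: derivative_eq_intros)
    have g: "(?g b a has_real_derivative ?D t) (at t)" for t
      by (rule DERIV_cong[OF DERIV_mult[OF DERIV_pow q]]) (simp add: algebra_simps)
    show ?case
    proof (rule bounded_derivs_SucI)
      fix x :: "real^'d"
      show "\<bar>(x $ i) ^ b * max 0 (1 - (x $ i)\<^sup>2) ^ a\<bar> \<le> real (b + 2 * a) ^ Suc k"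
        using coordinate_bump_le_1[of a "x $ i" b] Suc.prems one_le_power[OF N, of "Suc k"] unfolding N_def by linarith
      have "((\<lambda>x::real^'d. x $ i) has_derivative (\<lambda>v. v $ i)) (at x)"
        by (intro bounded_linear_imp_has_derivative bounded_linear_vec_nth)
      from has_derivative_compose[OF this, of "?g b a" "\<lambda>s. ?D (x $ i) * s"] g[of "x $ i"]
      have "((\<lambda>x. ?g b a (x $ i)) has_derivative (\<lambda>v. ?D (x $ i) * v $ i)) (at x)"
        by (simp add: has_field_derivative_def)
      then show "((\<lambda>x. ?g b a (x $ i)) has_derivative (\<lambda>v. v $ i * ?D (x $ i))) (at x)"
        by (simp add: mult.commute)
    next
      fix v :: "real^'d"
      have 1: "bounded_derivs k (\<bar>real b\<bar> * N ^ k) (\<lambda>x::real^'d. real b * ?g (b - 1) a (x $ i))"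
      proof (intro bounded_derivs_cmult bounded_derivs_mono[OF Suc.IH])
        show "real (b - 1 + 2 * a) ^ k \<le> N ^ k" unfolding N_def by (intro power_mono) auto
      qed (use Suc.prems in simp)
      have 2: "bounded_derivs k (\<bar>- 2 * real a\<bar> * N ^ k) (\<lambda>x::real^'d. (- 2 * real a) * ?g (b + 1) c (x $ i))"
      proof (intro bounded_derivs_cmult bounded_derivs_mono[OF Suc.IH])
        show "real (b + 1 + 2 * c) ^ k \<le> N ^ k" unfolding N_def c(1) by (intro power_mono) auto
      qed (use c in simp)
      from bounded_derivs_cmult[OF bounded_derivs_add[OF 1 2], of "v $ i"]
      show "bounded_derivs k (real (b + 2 * a) ^ Suc k * norm v) (\<lambda>x. v $ i * ?D (x $ i))"
      proof (rule bounded_derivs_mono)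
        have "\<bar>v $ i\<bar> * (N * N ^ k) \<le> norm v * (N * N ^ k)"
          using N by (intro mult_right_mono component_le_norm_cart) auto
        then show "\<bar>v $ i\<bar> * (\<bar>real b\<bar> * N ^ k + \<bar>- 2 * real a\<bar> * N ^ k) \<le> real (b + 2 * a) ^ Suc k * norm v"
          by (simp add: N_def algebra_simps)
      qed
    qed
qed

lemma smooth_bump_exists:
  "\<exists>(\<psi> :: real^'d \<Rightarrow> real) B. bounded_derivs k B \<psi> \<and> \<psi> 0 = 1 \<and>
    (\<forall>x. norm x > real CARD('d) \<longrightarrow> \<psi> x = 0)"
proof -
  define \<psi> where "\<psi> = (\<lambda>I (x::real^'d). \<Prod>i\<in>I. max 0 (1 - (x $ i)\<^sup>2) ^ Suc k)"
  have "\<exists>B. bounded_derivs k B (\<psi> I)" if "finite I" for I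
    using that
  proof (induction I)
    case empty
    show ?case by (intro exI[of _ 1]) (auto simp: \<psi>_def intro: bounded_derivs_const)
  next
    case (insert i I)
    then obtain B where "bounded_derivs k B (\<psi> I)" by auto
    from bounded_derivs_mult[OF bounded_derivs_coordinate_bump[of k "Suc k" 0 i] this]
    show ?case using insert by (auto simp: \<psi>_def)
  qed
  then obtain B where B: "bounded_derivs k B (\<psi> UNIV)" by auto
  show ?thesis
  proof (intro exI[of _ "\<psi> UNIV"] exI[of _ B] conjI allI impI B)
    show "\<psi> UNIV 0 = 1" by (simp add: \<psi>_def)
    fix x :: "real^'d" assume x: "norm x > real CARD('d)"
    have "\<exists>i. \<bar>x $ i\<bar> > 1"
    proof (rule ccontr)
      assume "\<not> (\<exists>i. \<bar>x $ i\<bar> > 1)"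
      then have "(\<Sum>i\<in>UNIV. \<bar>x $ i\<bar>) \<le> (\<Sum>i\<in>(UNIV::'d set). 1)" by (intro sum_mono) (auto simp: not_less)
      then show False using norm_le_l1_cart[of x] x by simp
    qed
    then obtain i where "\<bar>x $ i\<bar> > 1" by auto
    then have "(x $ i)\<^sup>2 > 1" using abs_square_le_1[of "x $ i"] by linarith
    then have "max 0 (1 - (x $ i)\<^sup>2) = 0" by simp
    then show "\<psi> UNIV x = 0" unfolding \<psi>_def by (intro prod_zero) (auto intro!: bexI[of _ i])
  qed
qed

text \<open>
  The order of the quantifiers matters: the constants serve all tuples of directions, while the kernel \<open>K\<close>,
  a translate of one fixed bump function, depends on the tuple.
\<close>

lemma kernel_exists:
  obtains B \<kappa> \<rho> :: real where "B > 0" "\<kappa> > 0" "\<rho> > 0"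
    "\<And>vs :: (real^'d) list. length vs \<le> k \<Longrightarrow> (\<And>v. v \<in> set vs \<Longrightarrow> norm v = 1) \<Longrightarrow>
      \<exists>K. bounded_derivs (Suc k) B K \<and> \<bar>iter_deriv K vs 0\<bar> \<ge> \<kappa> \<and>
        (\<forall>ws x. norm x \<ge> \<rho> \<longrightarrow> iter_deriv K ws x = 0)"
proof -
  define r where "r = real CARD('d)"
  obtain \<psi> :: "real^'d \<Rightarrow> real" and B where \<psi>: "bounded_derivs (Suc k) B \<psi>" "\<psi> 0 = 1"
    "\<And>x. norm x > r \<Longrightarrow> \<psi> x = 0"
        using smooth_bump_exists[where k="Suc k" and 'd='d] unfolding r_def by blast
  have r: "r \<ge> 0" by (simp add: r_def)
  have B: "B \<ge> 1" using bounded_derivs_bound[OF \<psi>(1), of 0] \<psi>(2) by simp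
  define \<kappa> where "\<kappa> = 1 / (2 * r + 1) ^ k"
  show thesis
  proof (rule that[of B \<kappa> "2 * r + 1"])
    show "B > 0" "\<kappa> > 0" "2 * r + 1 > 0" using B r by (auto simp: \<kappa>_def)
    fix vs :: "(real^'d) list"
    assume vs: "length vs \<le> k" "\<And>v. v \<in> set vs \<Longrightarrow> norm v = 1"
    obtain y where y: "norm y \<le> r" "\<bar>iter_deriv \<psi> vs y\<bar> \<ge> 1 / (2 * r + 1) ^ length vs"
      using iter_deriv_large[OF \<psi>(1,3) r, of vs] vs \<psi>(2) by auto
    define K where "K = (\<lambda>x. \<psi> (x + y))"
    have K: "iter_deriv K vs x = iter_deriv \<psi> vs (x + y)" for x
      using iter_deriv_sum_rescaled[OF \<psi>(1), where h=1 and vs=vs and J="{- y}" and a=1] vs(1) by (simp add: K_def)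
    show "\<exists>K. bounded_derivs (Suc k) B K \<and> \<bar>iter_deriv K vs 0\<bar> \<ge> \<kappa> \<and>
        (\<forall>ws x. norm x \<ge> 2 * r + 1 \<longrightarrow> iter_deriv K ws x = 0)"
    proof (intro exI[of _ K] conjI)
      show "bounded_derivs (Suc k) B K" unfolding K_def by (rule bounded_derivs_translate[OF \<psi>(1)])
      have "\<kappa> \<le> 1 / (2 * r + 1) ^ length vs" unfolding \<kappa>_def
        using r vs(1) by (intro divide_left_mono power_increasing) auto
      then show "\<kappa> \<le> \<bar>iter_deriv K vs 0\<bar>" using y by (simp add: K)
      have "K x = 0" if "norm x > 2 * r" for x
      proof -
        have "norm x \<le> norm (x + y) + norm y" by (metis add_diff_cancel_right' norm_triangle_ineq4)
        then show ?thesis unfolding K_def using that y by (intro \<psi>(3)) linarith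
      qed
      then show "\<forall>ws x. norm x \<ge> 2 * r + 1 \<longrightarrow> iter_deriv K ws x = 0"
        using iter_deriv_eq_0_outside[of "2 * r" K] by force
    qed
  qed
qed

section \<open>Sums of rescaled bumps in the Hoelder class\<close>

lemma strict_floor_bounds:
  assumes "\<beta> > 0"
  shows "real (strict_floor \<beta>) < \<beta>" "\<beta> \<le> real (strict_floor \<beta>) + 1"
proof -
  have "\<lceil>\<beta>\<rceil> \<ge> 1" using assms by linarith
  then show "real (strict_floor \<beta>) < \<beta>" "\<beta> \<le> real (strict_floor \<beta>) + 1"
    unfolding strict_floor_def by linarith+
qed

lemma le_strict_floor: "\<beta> > 0 \<Longrightarrow> real s < \<beta> \<Longrightarrow> s \<le> strict_floor \<beta>"
  using strict_floor_bounds[of \<beta>] by linarith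

text \<open>
  If at every point at most one bump is active, then a difference of two values of a sum of bumps involves at
  most two bumps.
\<close>

lemma abs_sum_diff_le_twice:
  fixes p q :: "'j \<Rightarrow> real"
  assumes J: "finite J" and p: "\<And>i j. i \<in> J \<Longrightarrow> j \<in> J \<Longrightarrow> p i \<noteq> 0 \<Longrightarrow> p j \<noteq> 0 \<Longrightarrow> i = j"
    and q: "\<And>i j. i \<in> J \<Longrightarrow> j \<in> J \<Longrightarrow> q i \<noteq> 0 \<Longrightarrow> q j \<noteq> 0 \<Longrightarrow> i = j"
    and M: "\<And>j. j \<in> J \<Longrightarrow> \<bar>p j - q j\<bar> \<le> M" "M \<ge> 0"
  shows "\<bar>(\<Sum>j\<in>J. p j) - (\<Sum>j\<in>J. q j)\<bar> \<le> 2 * M"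
proof -
  define S where "S = {j\<in>J. p j \<noteq> 0} \<union> {j\<in>J. q j \<noteq> 0}"
  have "card {j\<in>J. p j \<noteq> 0} \<le> 1" "card {j\<in>J. q j \<noteq> 0} \<le> 1"
    using J p q by (auto simp: card_le_Suc0_iff_eq)
  then have S: "card S \<le> 2" using card_Un_le[of "{j\<in>J. p j \<noteq> 0}" "{j\<in>J. q j \<noteq> 0}"] by (simp add: S_def)
  have "(\<Sum>j\<in>J. p j) - (\<Sum>j\<in>J. q j) = (\<Sum>j\<in>J. p j - q j)" by (simp add: sum_subtractf)
  also have "\<dots> = (\<Sum>j\<in>S. p j - q j)"
    using J by (intro sum.mono_neutral_right) (auto simp: S_def)
  finally have "\<bar>(\<Sum>j\<in>J. p j) - (\<Sum>j\<in>J. q j)\<bar> \<le> (\<Sum>j\<in>S. \<bar>p j - q j\<bar>)"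
    by (simp add: sum_abs)
  also have "\<dots> \<le> (\<Sum>j\<in>S. M)" using M by (intro sum_mono) (auto simp: S_def)
  also have "\<dots> = real (card S) * M" by simp
  also have "\<dots> \<le> 2 * M" using S M(2) by (intro mult_right_mono) auto
  finally show ?thesis .
qed

definition bumps :: "real \<Rightarrow> real \<Rightarrow> ('a::euclidean_space \<Rightarrow> real) \<Rightarrow> 'a set \<Rightarrow> 'a \<Rightarrow> real" where
  "bumps a h K J x = (\<Sum>z\<in>J. a * K ((x - z) /\<^sub>R h))"

definition separated :: "real \<Rightarrow> 'a::real_normed_vector set \<Rightarrow> bool" where
  "separated r J \<longleftrightarrow> (\<forall>z\<in>J. \<forall>z'\<in>J. z \<noteq> z' \<longrightarrow> norm (z - z') \<ge> 2 * r)"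

lemma separated_unique:
  assumes "separated r J" "z \<in> J" "z' \<in> J" "norm (x - z) < r" "norm (x - z') < r"
  shows "z = z'"
proof (rule ccontr)
  assume "z \<noteq> z'"
  then have "norm (z - z') \<ge> 2 * r" using assms by (auto simp: separated_def)
  moreover have "norm (z - z') \<le> norm (x - z') + norm (x - z)"
    using norm_triangle_ineq4[of "x - z'" "x - z"] by simp
  ultimately show False using assms by linarith
qed

text \<open>
  The kernel that \<open>kernel_exists\<close> provides for the directions \<open>vs\<close>, together with the amplitude factor \<open>c\<close>
  and the bandwidth \<open>h\<close> of the bumps.
\<close>

locale bump_kernel =
  fixes \<beta> B \<kappa> \<rho> c h :: real and K :: "'a::euclidean_space \<Rightarrow> real" and vs :: "'a list"
  assumes pos: "\<beta> > 0" "B > 0" "\<kappa> > 0" "\<rho> > 0" "c > 0" "h > 0"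
    and K: "bounded_derivs (Suc (strict_floor \<beta>)) B K"
    and K_outside: "\<And>ws x. norm x \<ge> \<rho> \<Longrightarrow> iter_deriv K ws x = 0"
    and K_at_0: "\<bar>iter_deriv K vs 0\<bar> \<ge> \<kappa>"
    and length_vs: "real (length vs) < \<beta>" and unit_vs: "\<And>v. v \<in> set vs \<Longrightarrow> norm v = 1"
begin

definition f :: "'a set \<Rightarrow> 'a \<Rightarrow> real" where
  "f = bumps (c * h powr \<beta>) h K"

lemma iter_deriv_f:
  assumes "length ws \<le> Suc (strict_floor \<beta>)"
  shows "iter_deriv (f J) ws = (\<lambda>x. \<Sum>z\<in>J. c * h powr (\<beta> - length ws) * iter_deriv K ws ((x - z) /\<^sub>R h))"
proof -
  have "h powr (\<beta> - length ws) = h powr \<beta> * inverse h ^ length ws"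
    using pos by (simp add: powr_diff powr_realpow divide_inverse power_inverse)
  then show ?thesis
    using iter_deriv_sum_rescaled[OF K pos(6) assms, where a="c * h powr \<beta>" and J=J]
    by (simp add: f_def bumps_def[abs_def] mult_ac)
qed

lemma kernel_term_eq_0: "\<rho> * h \<le> norm (x - z) \<Longrightarrow> iter_deriv K ws ((x - z) /\<^sub>R h) = 0"
  using pos by (intro K_outside) (simp add: pos_le_divide_eq flip: divide_inverse_commute)

lemma iter_deriv_f_near:
  assumes J: "separated (\<rho> * h) J" "finite J" "w \<subseteq> J" "z \<in> J" "norm (x - z) < \<rho> * h"
    and ws: "length ws \<le> Suc (strict_floor \<beta>)"
  shows "iter_deriv (f w) ws x =
    (if z \<in> w then c * h powr (\<beta> - length ws) * iter_deriv K ws ((x - z) /\<^sub>R h) else 0)"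
proof -
  let ?t = "\<lambda>z. c * h powr (\<beta> - length ws) * iter_deriv K ws ((x - z) /\<^sub>R h)"
  have "?t z' = 0" if "z' \<in> w" "z' \<noteq> z" for z'
    using separated_unique[OF J(1), of z z' x] that J kernel_term_eq_0[of x z'] by force
  then have "(\<Sum>z'\<in>w. ?t z') = (\<Sum>z'\<in>w. if z' = z then ?t z else 0)" by (intro sum.cong) auto
  also have "\<dots> = (if z \<in> w then ?t z else 0)"
    using finite_subset[OF J(3,2)] by simp
  finally show ?thesis using iter_deriv_f[OF ws] by simp
qed

lemma continuous_iter_deriv_f: "continuous_on UNIV (iter_deriv (f w) vs)"
proof -
  have vs: "length vs < Suc (strict_floor \<beta>)" using le_strict_floor[OF pos(1) length_vs] by simp
  have "continuous_on UNIV (iter_deriv K vs)"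
    using iter_deriv_differentiable[OF K vs]
    by (auto intro: differentiable_imp_continuous_on simp: differentiable_on_def)
  then have "continuous_on UNIV (\<lambda>x. iter_deriv K vs ((x - z) /\<^sub>R h))" for z
    by (rule continuous_on_compose2) (auto intro!: continuous_intros)
  then show ?thesis using vs by (simp add: iter_deriv_f continuous_on_sum continuous_on_mult_left)
qed

text \<open>
  The factor \<open>h powr \<beta>\<close> of a bump cancels the scaling of the \<open>\<beta>\<close>-Hoelder seminorm, so the Hoelder constant
  depends only on the kernel and \<open>c\<close>.  Since the kernel is bounded and Lipschitz together with its derivatives,
  the Hoelder quotients of its derivatives are at most \<open>2 * B\<close>; disjointness of the supports costs another factor 2.
\<close>

lemma f_in_holder_class:
  assumes J: "separated (\<rho> * h) J" "finite J"
    and L\<beta>: "4 * B * c \<le> L\<beta>"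
    and L: "\<And>k. k \<le> strict_floor \<beta> \<Longrightarrow> 2 * B * c * h powr (\<beta> - k) \<le> L k"
  shows "f J \<in> holder_class \<beta> L L\<beta>"
proof -
  let ?l = "strict_floor \<beta>"
  define \<theta> where "\<theta> = \<beta> - real ?l"
  have \<theta>: "0 < \<theta>" "\<theta> \<le> 1" using strict_floor_bounds[OF pos(1)] by (auto simp: \<theta>_def)
  have near: "norm (x - z) < \<rho> * h" if "b * iter_deriv K ws ((x - z) /\<^sub>R h) \<noteq> 0" for x z ws and b :: real
    using kernel_term_eq_0[of x z ws] that by (cases "\<rho> * h \<le> norm (x - z)") auto
  have fewer: "i = j" if "i \<in> J" "j \<in> J" "b * iter_deriv K ws ((x - i) /\<^sub>R h) \<noteq> 0"
    "b * iter_deriv K ws ((x - j) /\<^sub>R h) \<noteq> 0" for i j x ws b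
    by (rule separated_unique[OF J(1) that(1,2) near[OF that(3)] near[OF that(4)]])
  have diff: "iter_deriv (f J) ws differentiable (at x)" if "length ws < ?l" for ws x
  proof -
    have "iter_deriv K ws differentiable (at y)" for y
      using iter_deriv_differentiable[OF K] that by simp
    then have "(\<lambda>x. iter_deriv K ws ((x - z) /\<^sub>R h)) differentiable (at x)" for z
      by (rule differentiable_compose[where f="iter_deriv K ws" and g="\<lambda>x. (x - z) /\<^sub>R h"])
        (intro differentiable_scaleR differentiable_diff differentiable_const differentiable_ident)
    then have "(\<lambda>x. c * h powr (\<beta> - length ws) * iter_deriv K ws ((x - z) /\<^sub>R h)) differentiable (at x)" for z
      by (intro differentiable_mult differentiable_const)
    then show ?thesis using that J by (simp add: iter_deriv_f differentiable_sum)
  qed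
  have bound: "\<bar>iter_deriv (f J) ws x\<bar> \<le> L (length ws)"
    if ws: "length ws \<le> ?l" "\<forall>w\<in>set ws. norm w = 1" for ws x
  proof -
    let ?b = "c * h powr (\<beta> - length ws)"
    have b: "?b > 0" using pos by simp
    have "\<bar>iter_deriv K ws y\<bar> \<le> B" for y using iter_deriv_bound[OF K] ws by auto
    then have "\<bar>(\<Sum>z\<in>J. ?b * iter_deriv K ws ((x - z) /\<^sub>R h)) - (\<Sum>z\<in>J. 0)\<bar> \<le> 2 * (?b * B)"
      using b pos fewer[of _ _ ?b ws x]
      by (intro abs_sum_diff_le_twice J) (auto simp: abs_mult intro!: mult_left_mono)
    also have "\<dots> \<le> L (length ws)" using L[OF ws(1)] by (simp add: mult_ac)
    finally show ?thesis using ws by (simp add: iter_deriv_f)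
  qed
  have holder: "\<bar>iter_deriv (f J) ws x - iter_deriv (f J) ws x'\<bar> \<le> L\<beta> * norm (x - x') powr \<theta>"
    if ws: "length ws = ?l" "\<forall>w\<in>set ws. norm w = 1" for ws x x'
  proof -
    let ?b = "c * h powr \<theta>"
    let ?M = "2 * B * norm ((x - x') /\<^sub>R h) powr \<theta>"
    have b: "?b > 0" using pos by simp
    have M: "\<bar>iter_deriv K ws ((x - z) /\<^sub>R h) - iter_deriv K ws ((x' - z) /\<^sub>R h)\<bar> \<le> ?M" for z
    proof -
      let ?t = "norm ((x - x') /\<^sub>R h)"
      have e: "(x - z) /\<^sub>R h - (x' - z) /\<^sub>R h = (x - x') /\<^sub>R h" by (simp flip: scaleR_diff_right)
      have 1: "\<bar>iter_deriv K ws ((x - z) /\<^sub>R h) - iter_deriv K ws ((x' - z) /\<^sub>R h)\<bar> \<le> B * ?t"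
        using iter_deriv_lipschitz[OF K, of ws "(x - z) /\<^sub>R h" "(x' - z) /\<^sub>R h"] ws unfolding e by auto
      have 2: "\<bar>iter_deriv K ws ((x - z) /\<^sub>R h) - iter_deriv K ws ((x' - z) /\<^sub>R h)\<bar> \<le> 2 * B"
        using iter_deriv_bound[OF K, of ws "(x - z) /\<^sub>R h"] iter_deriv_bound[OF K, of ws "(x' - z) /\<^sub>R h"] ws
        by auto
      \<comment> \<open>The Lipschitz bound is used at short distances and the bound on the values at long ones.\<close>
      show ?thesis
      proof (cases "?t \<le> 1")
        case True
        have "?t powr 1 \<le> ?t powr \<theta>" using True \<theta> by (intro powr_mono') auto
        then have "B * ?t \<le> B * ?t powr \<theta>" using pos by (intro mult_left_mono) auto
        moreover have "0 \<le> B * ?t powr \<theta>" using pos by simp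
        ultimately show ?thesis using 1 by linarith
      next
        case False
        then have "1 \<le> ?t powr \<theta>" using \<theta> by (intro ge_one_powr_ge_zero) auto
        then have "2 * B * 1 \<le> 2 * B * ?t powr \<theta>" using pos by (intro mult_left_mono) auto
        then show ?thesis using 2 by linarith
      qed
    qed
    have "\<bar>(\<Sum>z\<in>J. ?b * iter_deriv K ws ((x - z) /\<^sub>R h)) - (\<Sum>z\<in>J. ?b * iter_deriv K ws ((x' - z) /\<^sub>R h))\<bar>
      \<le> 2 * (?b * ?M)"
    proof (intro abs_sum_diff_le_twice J)
      show "\<bar>?b * iter_deriv K ws ((x - z) /\<^sub>R h) - ?b * iter_deriv K ws ((x' - z) /\<^sub>R h)\<bar> \<le> ?b * ?M" for z
        unfolding right_diff_distrib[symmetric] abs_mult[of ?b] abs_of_pos[OF b]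
        using M[of z] b by (intro mult_left_mono) auto
      show "0 \<le> ?b * ?M" using pos by simp
    qed (use fewer[of _ _ ?b ws] in blast)+
    also have "2 * (?b * ?M) = 4 * B * c * norm (x - x') powr \<theta>"
    proof -
      have "norm ((x - x') /\<^sub>R h) = norm (x - x') / h" using pos by (simp add: divide_inverse_commute)
      then have "norm ((x - x') /\<^sub>R h) powr \<theta> = norm (x - x') powr \<theta> / h powr \<theta>"
        using pos by (simp add: powr_divide)
      then show ?thesis using pos by simp
    qed
    also have "\<dots> \<le> L\<beta> * norm (x - x') powr \<theta>" using L\<beta> by (intro mult_right_mono) auto
    finally show ?thesis using ws by (simp add: iter_deriv_f \<theta>_def)
  qed
  show ?thesis unfolding holder_class_def
  proof (intro CollectI conjI allI impI)
    show "times_differentiable ?l (f J)" using diff by (auto simp: times_differentiable_def)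
    show "(SUP x. form_norm k (\<lambda>ws. iter_deriv (f J) ws x)) \<le> ennreal (L k)" if "k \<le> ?l" for k
      using bound that by (auto simp: form_norm_def intro!: SUP_least ennreal_leI)
    show "form_norm ?l (\<lambda>ws. iter_deriv (f J) ws x - iter_deriv (f J) ws x')
      \<le> ennreal (L\<beta> * norm (x - x') powr (\<beta> - real ?l))" for x x'
      using holder by (auto simp: form_norm_def \<theta>_def intro!: SUP_least ennreal_leI)
  qed
qed

text \<open>
  The derivative of the kernel is at least \<open>\<kappa>\<close> at the origin and has the Lipschitz constant \<open>B\<close>, so it stays
  above \<open>\<kappa> / 2\<close> in the ball of radius \<open>\<kappa> / (2 * B)\<close>.
\<close>

lemma signal_near_center:
  assumes "separated (\<rho> * h) J" "finite J" "w \<subseteq> J" "w' \<subseteq> J" "z \<in> (w - w') \<union> (w' - w)"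
    and x: "norm (x - z) < min \<rho> (\<kappa> / (2 * B)) * h"
  shows "\<bar>iter_deriv (f w) vs x - iter_deriv (f w') vs x\<bar> \<ge> c * \<kappa> / 2 * h powr (\<beta> - length vs)"
proof -
  have vs: "length vs < Suc (strict_floor \<beta>)" using le_strict_floor[OF pos(1) length_vs] by simp
  have "min \<rho> (\<kappa> / (2 * B)) * h \<le> \<rho> * h" "min \<rho> (\<kappa> / (2 * B)) * h \<le> \<kappa> / (2 * B) * h"
    using pos by (intro mult_right_mono; simp)+
  then have x1: "norm (x - z) < \<rho> * h" "norm (x - z) < \<kappa> / (2 * B) * h" using x by linarith+
  let ?y = "(x - z) /\<^sub>R h"
  have ny: "norm ?y = norm (x - z) / h" using pos by (simp add: divide_inverse_commute)
  have "B * norm ?y \<le> \<kappa> / 2" unfolding ny using x1(2) pos by (simp add: field_simps)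
  then have y: "\<bar>iter_deriv K vs ?y\<bar> \<ge> \<kappa> / 2"
    using iter_deriv_lipschitz[OF K vs unit_vs, of ?y 0] K_at_0 by simp
  have "\<bar>iter_deriv (f w) vs x - iter_deriv (f w') vs x\<bar> = c * h powr (\<beta> - length vs) * \<bar>iter_deriv K vs ?y\<bar>"
    using assms iter_deriv_f_near[OF assms(1,2,3) _ x1(1), of vs] iter_deriv_f_near[OF assms(1,2,4) _ x1(1), of vs]
      vs pos by (auto simp: abs_mult)
  also have "\<dots> \<ge> c * h powr (\<beta> - length vs) * (\<kappa> / 2)" using y pos by (intro mult_left_mono) auto
  finally show ?thesis by (simp add: mult_ac)
qed

end

section \<open>Grids in the cube and the p-th power loss\<close>

text \<open>
  The points are the centres of cells of side \<open>2 * r\<close>, stacked from the corner at the origin.  Along each axis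
  the integral part of \<open>R / (2 * r)\<close> of them fit into the cube, and this is at least half of \<open>R / (2 * r)\<close>.
\<close>

lemma card_grid_cube:
  fixes R r :: real
  assumes r: "0 < r" "2 * r \<le> R"
  shows "\<exists>J :: (real^'d) set. finite J \<and> separated r J \<and> (\<forall>z\<in>J. ball z r \<subseteq> cube R) \<and>
    real (card J) \<ge> (R / (4 * r)) ^ CARD('d)"
proof -
  define N where "N = nat \<lfloor>R / (2 * r)\<rfloor>"
  have q: "R / (2 * r) \<ge> 1" using r by simp
  then have N1: "real N \<le> R / (2 * r)" "R / (2 * r) < real N + 1" "N \<ge> 1"
    unfolding N_def by linarith+
  have N2: "2 * r * real N \<le> R" using N1(1) r by (simp add: field_simps)
  have "R / (4 * r) = R / (2 * r) / 2" by simp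
  with N1 have N3: "R / (4 * r) \<le> real N" by linarith
  define Z :: "('d \<Rightarrow> nat) \<Rightarrow> real^'d" where "Z = (\<lambda>k. \<chi> i. (2 * real (k i) + 1) * r)"
  define I :: "('d \<Rightarrow> nat) set" where "I = (\<Pi>\<^sub>E i\<in>UNIV. {..<N})"
  have sep: "2 * r \<le> norm (Z k - Z k')" if "k \<noteq> k'" for k k'
  proof -
    obtain i where i: "k i \<noteq> k' i" using \<open>k \<noteq> k'\<close> by auto
    then have "\<bar>real (k i) - real (k' i)\<bar> \<ge> 1" by linarith
    then have "2 * r * 1 \<le> 2 * r * \<bar>real (k i) - real (k' i)\<bar>" using r by (intro mult_left_mono) auto
    also have "\<dots> = \<bar>2 * r * (real (k i) - real (k' i))\<bar>" using r by (simp add: abs_mult)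
    also have "2 * r * (real (k i) - real (k' i)) = (Z k - Z k') $ i" by (simp add: Z_def algebra_simps)
    also have "\<bar>(Z k - Z k') $ i\<bar> \<le> norm (Z k - Z k')" by (rule component_le_norm_cart)
    finally show ?thesis by simp
  qed
  have inj: "inj_on Z I"
  proof (rule inj_onI, rule ccontr)
    fix k k' assume "Z k = Z k'" "k \<noteq> k'"
    then show False using sep[of k k'] r by simp
  qed
  show ?thesis
  proof (intro exI[of _ "Z ` I"] conjI ballI)
    show "finite (Z ` I)" unfolding I_def by (intro finite_imageI finite_PiE) auto
    show "separated r (Z ` I)" unfolding separated_def by (metis imageE sep)
    show "(R / (4 * r)) ^ CARD('d) \<le> real (card (Z ` I))"
    proof -
      have "card (Z ` I) = N ^ CARD('d)" using card_image[OF inj] by (simp add: I_def card_PiE)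
      then show ?thesis using power_mono[OF N3, of "CARD('d)"] r by simp
    qed
    fix z assume "z \<in> Z ` I"
    then obtain k where k: "z = Z k" "\<And>i. k i < N" by (auto simp: I_def PiE_iff)
    show "ball z r \<subseteq> cube R"
    proof
      fix y assume y: "y \<in> ball z r"
      have "0 \<le> y $ i \<and> y $ i \<le> R" for i
      proof -
        have "\<bar>(y - z) $ i\<bar> \<le> norm (y - z)" by (rule component_le_norm_cart)
        also have "\<dots> < r" using y by (simp add: dist_norm norm_minus_commute)
        finally have "\<bar>y $ i - (2 * real (k i) + 1) * r\<bar> < r" by (simp add: k Z_def)
        then have "(2 * real (k i) + 1) * r - r < y $ i" "y $ i < (2 * real (k i) + 1) * r + r" by linarith+
        moreover have "(2 * real (k i) + 1) * r - r = 2 * real (k i) * r"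
          "(2 * real (k i) + 1) * r + r = (2 * real (k i) + 2) * r" by (simp_all add: algebra_simps)
        moreover have "0 \<le> 2 * real (k i) * r" using r by simp
        moreover have "(2 * real (k i) + 2) * r \<le> 2 * real N * r"
          using k(2)[of i] r by (intro mult_right_mono) auto
        moreover have "2 * real N * r \<le> R" using N2 by (simp add: mult_ac)
        ultimately show ?thesis by linarith
      qed
      then show "y \<in> cube R" by (simp add: cube_def)
    qed
  qed
qed

lemma nn_integral_powr_le_of_Lp_norm:
  assumes p: "p \<ge> 1" and pos: "C > 0" "R > 0" "q > 0"
    and small: "\<not> ennreal q \<le> ennreal (C * R powr (- real d / p)) * Lp_norm p M u"
  shows "(\<integral>\<^sup>+ x. ennreal (\<bar>u x\<bar> powr p) \<partial>M) \<le> ennreal (q powr p * R ^ d / C powr p)"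
proof -
  define I where "I = (\<integral>\<^sup>+ x. ennreal (\<bar>u x\<bar> powr p) \<partial>M)"
  have cp: "C * R powr (- real d / p) > 0" using pos by simp
  have I: "I \<noteq> \<infinity>"
  proof
    assume "I = \<infinity>"
    then have "Lp_norm p M u = \<infinity>" by (simp add: Lp_norm_def I_def)
    then show False using small pos by (simp add: ennreal_mult_top)
  qed
  define t where "t = enn2real I"
  have t: "I = ennreal t" "t \<ge> 0" using I by (auto simp: t_def less_top)
  have "Lp_norm p M u = ennreal (t powr (1 / p))" using I by (simp add: Lp_norm_def I_def[symmetric] t_def)
  then have "ennreal (C * R powr (- real d / p) * t powr (1 / p)) < ennreal q"
    using small cp by (simp add: not_le ennreal_mult)
  then have "C * R powr (- real d / p) * t powr (1 / p) < q"
    using pos by (simp add: ennreal_less_iff)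
  then have "(C * R powr (- real d / p) * t powr (1 / p)) powr p \<le> q powr p"
    using cp p by (intro powr_mono2) auto
  also have "(C * R powr (- real d / p) * t powr (1 / p)) powr p = C powr p * R powr (- real d) * t"
    using pos p t by (simp add: powr_mult powr_powr)
  also have "R powr (- real d) = 1 / R ^ d" using pos by (simp add: powr_minus powr_realpow divide_inverse)
  finally have "t \<le> q powr p * R ^ d / C powr p" using pos by (simp add: field_simps)
  then show ?thesis unfolding I_def[symmetric] t(1) by (rule ennreal_leI)
qed

text \<open>
  This convexity-type bound serves instead of the Minkowski inequality; it loses only a constant.
\<close>

lemma nn_integral_powr_triangle:
  fixes u v :: "'a \<Rightarrow> real"
  assumes p: "p \<ge> 1" and [measurable]: "u \<in> borel_measurable M" "v \<in> borel_measurable M"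
  shows "(\<integral>\<^sup>+ x. ennreal (\<bar>u x - v x\<bar> powr p) \<partial>M) \<le>
    ennreal (2 powr p) * ((\<integral>\<^sup>+ x. ennreal (\<bar>u x\<bar> powr p) \<partial>M) + (\<integral>\<^sup>+ x. ennreal (\<bar>v x\<bar> powr p) \<partial>M))"
proof -
  have "(\<integral>\<^sup>+ x. ennreal (\<bar>u x - v x\<bar> powr p) \<partial>M) \<le>
      (\<integral>\<^sup>+ x. ennreal (2 powr p) * (ennreal (\<bar>u x\<bar> powr p) + ennreal (\<bar>v x\<bar> powr p)) \<partial>M)"
  proof (rule nn_integral_mono)
    fix x
    have "\<bar>u x - v x\<bar> powr p \<le> (2 * max \<bar>u x\<bar> \<bar>v x\<bar>) powr p" using p by (intro powr_mono2) auto
    also have "\<dots> = 2 powr p * max \<bar>u x\<bar> \<bar>v x\<bar> powr p" by (simp add: powr_mult)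
    also have "\<dots> \<le> 2 powr p * (\<bar>u x\<bar> powr p + \<bar>v x\<bar> powr p)"
      by (intro mult_left_mono) (auto simp: max_def)
    finally show "ennreal (\<bar>u x - v x\<bar> powr p) \<le> ennreal (2 powr p) * (ennreal (\<bar>u x\<bar> powr p) + ennreal (\<bar>v x\<bar> powr p))"
      by (simp flip: ennreal_plus ennreal_mult)
  qed
  also have "\<dots> = ennreal (2 powr p) * ((\<integral>\<^sup>+ x. ennreal (\<bar>u x\<bar> powr p) \<partial>M) + (\<integral>\<^sup>+ x. ennreal (\<bar>v x\<bar> powr p) \<partial>M))"
    by (simp add: nn_integral_cmult nn_integral_add)
  finally show ?thesis .
qed

section \<open>The regression model with bump hypotheses\<close>

locale regression_bumps = bump_kernel \<beta> B \<kappa> \<rho> c h K vs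
  for \<beta> B \<kappa> \<rho> c h :: real and K :: "real^'d \<Rightarrow> real" and vs :: "(real^'d) list" +
  fixes R \<tau> \<epsilon> Cn Cc L\<beta> :: real and L :: "nat \<Rightarrow> real" and n :: nat and x :: "nat \<Rightarrow> real^'d" and P :: "real measure"
  assumes pos': "R > 0" "\<tau> > 0" "n > 0" "Cn > 0" "Cc > 0"
    and bandwidth: "h = (R ^ CARD('d) * \<tau> / real n) powr (1 / (2 * \<beta> + real CARD('d)))"
    and noise: "prob_space P" "sets P = sets borel" "noise_cond Cn P"
    and cover: "cover_scaled Cc R n x" and many: "1 / real n \<le> Cc * (\<rho> * h / R) ^ CARD('d)"
    and budget: "Cn * c\<^sup>2 * B\<^sup>2 * Cc * \<rho> ^ CARD('d) \<le> \<epsilon>"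
    and L\<beta>: "4 * B * c \<le> L\<beta>"
    and L: "\<And>k. k \<le> strict_floor \<beta> \<Longrightarrow> 2 * B * c * h powr (\<beta> - k) \<le> L k"
begin

abbreviation "law w \<equiv> obs_law P n x (f w)"

abbreviation "sample_space \<equiv> (\<Pi>\<^sub>M i\<in>{1..n}. borel :: real measure)"

lemma rate: "h powr (\<beta> - length vs) = (R ^ CARD('d) * \<tau> / real n) powr ((\<beta> - length vs) / (2 * \<beta> + real CARD('d)))"
  unfolding bandwidth powr_powr by simp

lemma bandwidth_power: "(h powr \<beta>)\<^sup>2 * h ^ CARD('d) = R ^ CARD('d) * \<tau> / real n"
proof -
  have "(h powr \<beta>)\<^sup>2 * h ^ CARD('d) = h powr \<beta> * h powr \<beta> * h powr real CARD('d)"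
    using pos by (simp add: powr_realpow power2_eq_square)
  also have "\<dots> = h powr (\<beta> + \<beta> + real CARD('d))" by (simp only: powr_add)
  also have "\<dots> = h powr (2 * \<beta> + real CARD('d))" by simp
  also have "\<dots> = (R ^ CARD('d) * \<tau> / real n) powr (1 / (2 * \<beta> + real CARD('d)) * (2 * \<beta> + real CARD('d)))"
    by (simp only: bandwidth powr_powr)
  also have "1 / (2 * \<beta> + real CARD('d)) * (2 * \<beta> + real CARD('d)) = 1"
    using pos(1) add_pos_nonneg[of "2 * \<beta>" "real CARD('d)"] by simp
  also have "(R ^ CARD('d) * \<tau> / real n) powr 1 = R ^ CARD('d) * \<tau> / real n" using pos' by simp
  finally show ?thesis .
qed

lemma f_diff_insert: "finite w \<Longrightarrow> z \<notin> w \<Longrightarrow> f (insert z w) y - f w y = c * h powr \<beta> * K ((y - z) /\<^sub>R h)"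
  by (simp add: f_def bumps_def)

text \<open>
  Only design points in the support of the bump contribute.  Their number is controlled by the design condition, and
  \<open>bandwidth_power\<close> says that the number of points times the squared height of the bump is of order \<open>\<tau>\<close>.
\<close>

lemma information_one_bump:
  assumes w: "finite w" "z \<notin> w" "z \<in> cube R"
  shows "(\<Sum>i\<in>{1..n}. Cn * \<bar>f (insert z w) (x i) - f w (x i)\<bar>\<^sup>2) \<le> \<epsilon> * \<tau>"
proof -
  let ?a = "c * h powr \<beta>"
  let ?S = "{i\<in>{1..n}. norm (x i - z) < \<rho> * h}"
  have t: "Cn * \<bar>f (insert z w) (x i) - f w (x i)\<bar>\<^sup>2 \<le> (if norm (x i - z) < \<rho> * h then Cn * (?a * B)\<^sup>2 else 0)" for i
  proof (cases "norm (x i - z) < \<rho> * h")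
    case True
    have "\<bar>K ((x i - z) /\<^sub>R h)\<bar> \<le> B" using bounded_derivs_bound[OF K] .
    then have "\<bar>?a * K ((x i - z) /\<^sub>R h)\<bar> \<le> ?a * B" using pos by (simp add: abs_mult mult_left_mono)
    then have "\<bar>?a * K ((x i - z) /\<^sub>R h)\<bar>\<^sup>2 \<le> (?a * B)\<^sup>2" by (intro power_mono) auto
    then show ?thesis using True pos' unfolding f_diff_insert[OF w(1,2)] by (simp only: if_True) (intro mult_left_mono, auto)
  next
    case False
    then have "K ((x i - z) /\<^sub>R h) = 0" using kernel_term_eq_0[of "x i" z "[]"] by simp
    then show ?thesis using w False by (simp add: f_diff_insert)
  qed
  have "real (card ?S) / real n \<le> max (1 / real n) (Cc * (\<rho> * h / R) ^ CARD('d))"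
    using cover w(3) pos unfolding cover_scaled_def by (simp del: max_less_iff_conj)
  then have cardS: "real (card ?S) \<le> real n * (Cc * (\<rho> * h / R) ^ CARD('d))"
    using many pos' by (simp add: field_simps max_absorb2)
  have "(\<Sum>i\<in>{1..n}. Cn * \<bar>f (insert z w) (x i) - f w (x i)\<bar>\<^sup>2)
    \<le> (\<Sum>i\<in>{1..n}. if norm (x i - z) < \<rho> * h then Cn * (?a * B)\<^sup>2 else 0)" by (intro sum_mono t)
  also have "\<dots> = real (card ?S) * (Cn * (?a * B)\<^sup>2)"
    by (simp add: sum.If_cases Int_def)
  also have "\<dots> \<le> real n * (Cc * (\<rho> * h / R) ^ CARD('d)) * (Cn * (?a * B)\<^sup>2)"
    using pos' by (intro mult_right_mono cardS) auto
  also have "\<dots> = (Cn * c\<^sup>2 * B\<^sup>2 * Cc * \<rho> ^ CARD('d)) * ((h powr \<beta>)\<^sup>2 * h ^ CARD('d) * real n / R ^ CARD('d))"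
    by (simp add: power_divide power_mult_distrib)
  also have "\<dots> = (Cn * c\<^sup>2 * B\<^sup>2 * Cc * \<rho> ^ CARD('d)) * \<tau>"
    unfolding bandwidth_power using pos' by simp
  also have "\<dots> \<le> \<epsilon> * \<tau>" using budget pos' by (intro mult_right_mono) auto
  finally show ?thesis .
qed

lemma law_change_of_measure:
  assumes w: "finite w" "z \<notin> w" "z \<in> cube R" and A: "A \<in> sets sample_space" "0 \<le> lam"
  shows "lam * measure (law (insert z w)) A \<le> \<epsilon> * \<tau> + ln (1 + (exp lam - 1) * measure (law w) A)"
  by (rule order_trans[OF obs_law_event_change_of_measure[OF noise A, where f="f (insert z w)" and g="f w" and x=x]
    add_right_mono[OF information_one_bump[OF w]]])

lemma law_prob_space: "prob_space (law w)"
proof -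
  have [measurable_cong]: "sets P = sets borel" by (rule noise)
  show ?thesis
    unfolding obs_law_eq_PiM[OF noise(1,2)] shift_def using noise(1)
    by (intro prob_space_PiM prob_space.prob_space_distr) auto
qed

lemma sets_law: "sets (law w) = sets sample_space"
  by (simp add: obs_law_def)

lemma law_close:
  assumes w: "finite w" "z \<notin> w" "z \<in> cube R" and A: "A \<in> sets sample_space" and small: "\<epsilon> * \<tau> \<le> 1 / 256"
  shows "measure (law (insert z w)) A - measure (law w) A \<le> 1 / 8"
  by (rule total_variation_of_change_of_measure[OF law_change_of_measure[OF w A] measure_nonneg
    prob_space.prob_le_1[OF law_prob_space] small])

lemma iter_deriv_f_center_diff:
  assumes "separated (\<rho> * h) J" "finite J" "w \<subseteq> J" "w' \<subseteq> J" "z \<in> (w - w') \<union> (w' - w)"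
  shows "\<bar>iter_deriv (f w) vs z - iter_deriv (f w') vs z\<bar> \<ge> c * \<kappa> / 2 * h powr (\<beta> - length vs)"
  using pos by (intro signal_near_center[OF assms]) simp

lemma holder_witness:
  assumes "separated (\<rho> * h) J" "finite J" "w \<subseteq> J" "outer_measure_of (law w) {y\<in>space sample_space. E (f w) y} \<ge> ennreal (1 / 4)"
  shows "(SUP f\<in>holder_class \<beta> L L\<beta>. obs_prob P n x f (E f)) \<ge> 1 / 4"
proof (rule SUP_upper2)
  have "separated (\<rho> * h) w" "finite w" using assms(1-3) by (auto simp: separated_def intro: finite_subset)
  then show "f w \<in> holder_class \<beta> L L\<beta>" by (rule f_in_holder_class[OF _ _ L\<beta> L])
  have "ennreal (1 / 4) = 1 / 4" by (simp add: divide_ennreal[symmetric])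
  then show "1 / 4 \<le> obs_prob P n x (f w) (E (f w))" using assms(4) by (simp add: obs_prob_def)
qed

text \<open>
  Assouad's lemma with a single bump at \<open>x\<^sub>0\<close>, where it reduces to the comparison of two hypotheses.
\<close>

lemma pointwise_lower_bound:
  assumes small: "\<epsilon> * \<tau> \<le> 1 / 256" and C: "C > 0" "C * (c * \<kappa>) \<ge> 4" and x0: "x\<^sub>0 \<in> cube R"
  shows "(SUP f\<in>holder_class \<beta> L L\<beta>. obs_prob P n x f (\<lambda>y.
    C * \<bar>g y x\<^sub>0 - iter_deriv f vs x\<^sub>0\<bar> \<ge> h powr (\<beta> - length vs))) \<ge> 1 / 4"
proof -
  let ?r = "h powr (\<beta> - length vs)"
  let ?E = "\<lambda>f y. C * \<bar>g y x\<^sub>0 - iter_deriv f vs x\<^sub>0\<bar> \<ge> ?r"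
  have sep: "separated (\<rho> * h) {x\<^sub>0}" by (simp add: separated_def)
  have "\<exists>w\<subseteq>{x\<^sub>0}. outer_measure_of (law w) {y\<in>space sample_space. ?E (f w) y} \<ge> ennreal (1 / 4)"
  proof (rule assouad)
    show "prob_space (law w)" "sets (law w) = sets sample_space" for w
      by (rule law_prob_space sets_law)+
    show "measure (law (insert z w)) A - measure (law w) A \<le> 1 / 8"
      if "z \<in> {x\<^sub>0}" "w \<subseteq> {x\<^sub>0} - {z}" "A \<in> sets sample_space" for z w A
      using that x0 by (intro law_close small) auto
    fix w w' y assume w: "w \<subseteq> {x\<^sub>0}" "w' \<subseteq> {x\<^sub>0}" and E: "\<not> ?E (f w) y" "\<not> ?E (f w') y"
    have "(w - w') \<union> (w' - w) = {}"
    proof (rule ccontr)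
      assume "(w - w') \<union> (w' - w) \<noteq> {}"
      then have z: "x\<^sub>0 \<in> (w - w') \<union> (w' - w)" using w by auto
      have "C * (c * \<kappa> / 2 * ?r) \<le> C * \<bar>iter_deriv (f w) vs x\<^sub>0 - iter_deriv (f w') vs x\<^sub>0\<bar>"
        using iter_deriv_f_center_diff[OF sep _ w z] C by (intro mult_left_mono) auto
      also have "\<dots> \<le> C * (\<bar>g y x\<^sub>0 - iter_deriv (f w) vs x\<^sub>0\<bar> + \<bar>g y x\<^sub>0 - iter_deriv (f w') vs x\<^sub>0\<bar>)"
        using C by (intro mult_left_mono) auto
      also have "\<dots> < 2 * ?r" using E by (simp add: algebra_simps)
      finally have "C * (c * \<kappa>) * ?r < 4 * ?r" by (simp add: mult_ac)
      then show False using C pos by simp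
    qed
    then have "card ((w - w') \<union> (w' - w)) = 0" by (metis card.empty)
    then show "16 * real (card ((w - w') \<union> (w' - w))) < 3 * real (card {x\<^sub>0})" by simp
  qed auto
  then obtain w where "w \<subseteq> {x\<^sub>0}" "outer_measure_of (law w) {y\<in>space sample_space. ?E (f w) y} \<ge> ennreal (1 / 4)"
    by blast
  then show ?thesis by (rule holder_witness[OF sep finite.insertI[OF finite.emptyI], of w ?E])
qed

text \<open>
  The hypotheses have exactly one bump, at a grid point, and the absence of any bump is the reference measure of
  \<open>fano\<close>.  The information \<open>\<epsilon> * \<tau>\<close> has to be compared with the logarithm of the number of grid points.
\<close>

lemma uniform_lower_bound:
  assumes C: "C > 0" "C * (c * \<kappa>) \<ge> 4" and h: "2 * (\<rho> * h) \<le> R"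
    and small: "\<epsilon> * \<tau> + ln 2 \<le> 3 / 4 * (CARD('d) * ln (R / (4 * (\<rho> * h))))"
  shows "(SUP f\<in>holder_class \<beta> L L\<beta>. obs_prob P n x f (\<lambda>y.
    ennreal C * (SUP z\<in>cube R. ennreal \<bar>g y z - iter_deriv f vs z\<bar>) \<ge> ennreal (h powr (\<beta> - length vs)))) \<ge> 1 / 4"
proof -
  let ?r = "h powr (\<beta> - length vs)"
  let ?E = "\<lambda>f y. ennreal C * (SUP z\<in>cube R. ennreal \<bar>g y z - iter_deriv f vs z\<bar>) \<ge> ennreal ?r"
  have \<rho>h: "\<rho> * h > 0" using pos by simp
  obtain J :: "(real^'d) set" where J: "finite J" "separated (\<rho> * h) J"
    "\<And>z. z \<in> J \<Longrightarrow> ball z (\<rho> * h) \<subseteq> cube R" "real (card J) \<ge> (R / (4 * (\<rho> * h))) ^ CARD('d)"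
    using card_grid_cube[OF \<rho>h h, where 'd='d] by blast
  have cube: "z \<in> cube R" if "z \<in> J" for z using J(3)[OF that] \<rho>h by auto
  have gp: "(R / (4 * (\<rho> * h))) ^ CARD('d) > 0" using \<rho>h pos' by simp
  then have cardJ: "card J > 0" using J(4) by simp
  have pt: "C * \<bar>g y z - iter_deriv f' vs z\<bar> < ?r" if "\<not> ?E f' y" "z \<in> J" for f' y z
  proof -
    have "ennreal (C * \<bar>g y z - iter_deriv f' vs z\<bar>) = ennreal C * ennreal \<bar>g y z - iter_deriv f' vs z\<bar>"
      using C by (simp add: ennreal_mult)
    also have "\<dots> \<le> ennreal C * (SUP z\<in>cube R. ennreal \<bar>g y z - iter_deriv f' vs z\<bar>)"
      using cube[OF that(2)] by (intro mult_left_mono SUP_upper) auto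
    also have "\<dots> < ennreal ?r" using that(1) by (simp add: not_le)
    finally show ?thesis using C by (simp add: ennreal_less_iff)
  qed
  have "\<exists>z\<in>J. outer_measure_of (law {z}) {y\<in>space sample_space. ?E (f {z}) y} \<ge> ennreal (1 / 4)"
  proof (rule fano)
    show "finite J" "J \<noteq> {}" using J cardJ by auto
    show "prob_space (law w)" "sets (law w) = sets sample_space" for w
      by (rule law_prob_space sets_law)+
    show "prob_space (law {})" "sets (law {}) = sets sample_space"
      by (rule law_prob_space sets_law)+
    show "lam * measure (law {z}) A \<le> \<epsilon> * \<tau> + ln (1 + (exp lam - 1) * measure (law {}) A)"
      if "z \<in> J" "A \<in> sets sample_space" "0 \<le> lam" for z A lam
      using that cube by (intro law_change_of_measure) auto
    have "CARD('d) * ln (R / (4 * (\<rho> * h))) = ln ((R / (4 * (\<rho> * h))) ^ CARD('d))"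
      using \<rho>h pos' by (simp add: ln_realpow)
    also have "\<dots> \<le> ln (real (card J))" using J(4) gp by simp
    finally show "\<epsilon> * \<tau> + ln 2 \<le> 3 / 4 * ln (real (card J))" using small by linarith
    fix z z' y assume z: "z \<in> J" "z' \<in> J" and E: "\<not> ?E (f {z}) y" "\<not> ?E (f {z'}) y"
    show "z = z'"
    proof (rule ccontr)
      assume ne: "z \<noteq> z'"
      have "C * (c * \<kappa> / 2 * ?r) \<le> C * \<bar>iter_deriv (f {z}) vs z - iter_deriv (f {z'}) vs z\<bar>"
        using iter_deriv_f_center_diff[OF J(2,1), of "{z}" "{z'}" z] C z ne by (intro mult_left_mono) auto
      also have "\<dots> \<le> C * (\<bar>g y z - iter_deriv (f {z}) vs z\<bar> + \<bar>g y z - iter_deriv (f {z'}) vs z\<bar>)"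
        using C by (intro mult_left_mono) auto
      also have "\<dots> < 2 * ?r" using pt[OF E(1) z(1)] pt[OF E(2) z(1)] by (simp add: algebra_simps)
      finally have "C * (c * \<kappa>) * ?r < 4 * ?r" by (simp add: mult_ac)
      then show False using C pos by simp
    qed
  qed
  then obtain z where z: "z \<in> J" "outer_measure_of (law {z}) {y\<in>space sample_space. ?E (f {z}) y} \<ge> ennreal (1 / 4)" by blast
  show ?thesis
    by (rule holder_witness[OF J(2,1), of "{z}" ?E, OF _ z(2)]) (use z(1) in blast)
qed

end

lemma cube_eq_cbox: "(cube R :: (real^'d) set) = cbox 0 (\<chi> i. R)"
  by (auto simp: cube_def mem_box_cart)

lemma sets_cube: "(cube R :: (real^'d) set) \<in> sets lebesgue"
  unfolding cube_eq_cbox by simp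

lemma emeasure_ball_in_cube:
  fixes z :: "real^'d"
  assumes "ball z r \<subseteq> cube R" "r \<ge> 0"
  shows "emeasure (lebesgue_on (cube R)) (ball z r) = ennreal (unit_ball_vol (real CARD('d)) * r ^ CARD('d))"
  using assms sets_cube[of R, where 'd='d]
  by (simp add: emeasure_restrict_space emeasure_ball)

context regression_bumps
begin

text \<open>
  Every centre in which \<open>w\<close> and \<open>w'\<close> differ contributes the integral over a small ball around it, and these balls are
  disjoint.
\<close>

lemma hamming_le_Lp_loss:
  assumes J: "separated (\<rho> * h) J" "finite J" "\<And>z. z \<in> J \<Longrightarrow> ball z (\<rho> * h) \<subseteq> cube R"
    and w: "w \<subseteq> J" "w' \<subseteq> J" and p: "p \<ge> 1"
  shows "ennreal (real (card ((w - w') \<union> (w' - w))) * ((c * \<kappa> / 2 * h powr (\<beta> - length vs)) powr p *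
      (unit_ball_vol (real CARD('d)) * (min \<rho> (\<kappa> / (2 * B)) * h) ^ CARD('d))))
    \<le> (\<integral>\<^sup>+ y. ennreal (\<bar>iter_deriv (f w) vs y - iter_deriv (f w') vs y\<bar> powr p) \<partial>lebesgue_on (cube R))"
proof -
  define S where "S = (w - w') \<union> (w' - w)"
  define r where "r = min \<rho> (\<kappa> / (2 * B)) * h"
  define t where "t = (c * \<kappa> / 2 * h powr (\<beta> - length vs)) powr p"
  have S: "finite S" "S \<subseteq> J" using w J(2) by (auto simp: S_def finite_subset)
  have r: "r > 0" "r \<le> \<rho> * h" using pos by (auto simp: r_def intro!: mult_right_mono)
  have sub: "ball z r \<subseteq> cube R" if "z \<in> S" for z
    using J(3)[of z] S that r(2) by force
  have m: "ball z r \<in> sets (lebesgue_on (cube R))" if "z \<in> S" for z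
    using sub[OF that] sets_cube[of R, where 'd='d] by (simp add: sets_restrict_space_iff)
  have "ennreal (real (card S) * (t * (unit_ball_vol (real CARD('d)) * r ^ CARD('d)))) =
    (\<Sum>z\<in>S. ennreal t * ennreal (unit_ball_vol (real CARD('d)) * r ^ CARD('d)))"
    using r by (simp add: ennreal_mult t_def ennreal_of_nat_eq_real_of_nat)
  also have "\<dots> = (\<Sum>z\<in>S. \<integral>\<^sup>+ y. ennreal t * indicator (ball z r) y \<partial>lebesgue_on (cube R))"
    using m sub r by (intro sum.cong refl) (simp add: nn_integral_cmult_indicator emeasure_ball_in_cube)
  also have "\<dots> = (\<integral>\<^sup>+ y. (\<Sum>z\<in>S. ennreal t * indicator (ball z r) y) \<partial>lebesgue_on (cube R))"
    using m by (intro nn_integral_sum[symmetric]) auto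
  also have "\<dots> \<le> (\<integral>\<^sup>+ y. ennreal (\<bar>iter_deriv (f w) vs y - iter_deriv (f w') vs y\<bar> powr p) \<partial>lebesgue_on (cube R))"
  proof (rule nn_integral_mono)
    fix y :: "real^'d"
    show "(\<Sum>z\<in>S. ennreal t * indicator (ball z r) y) \<le>
      ennreal (\<bar>iter_deriv (f w) vs y - iter_deriv (f w') vs y\<bar> powr p)"
    proof (cases "\<exists>z\<in>S. y \<in> ball z r")
      case True
      then obtain z where z: "z \<in> S" "y \<in> ball z r" by auto
      have dz: "norm (y - z) < r" using z(2) by (simp add: dist_norm norm_minus_commute)
      have uniq: "z' = z" if "z' \<in> S" "y \<in> ball z' r" for z'
      proof (rule separated_unique[OF J(1)])
        show "z' \<in> J" "z \<in> J" using that z(1) S(2) by auto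
        show "norm (y - z') < \<rho> * h" "norm (y - z) < \<rho> * h"
          using that(2) dz r(2) by (simp_all add: dist_norm norm_minus_commute)
      qed
      have "(\<Sum>z'\<in>S. ennreal t * indicator (ball z' r) y) = (\<Sum>z'\<in>S. if z' = z then ennreal t else 0)"
      proof (rule sum.cong[OF refl])
        fix z' assume "z' \<in> S"
        then have "y \<in> ball z' r \<longleftrightarrow> z' = z" using uniq z(2) by blast
        then show "ennreal t * indicator (ball z' r) y = (if z' = z then ennreal t else 0)"
          unfolding indicator_def by simp
      qed
      also have "\<dots> = ennreal t" using S(1) z(1) by simp
      also have "\<dots> \<le> ennreal (\<bar>iter_deriv (f w) vs y - iter_deriv (f w') vs y\<bar> powr p)"
      proof (rule ennreal_leI)
        have "c * \<kappa> / 2 * h powr (\<beta> - length vs) \<le> \<bar>iter_deriv (f w) vs y - iter_deriv (f w') vs y\<bar>"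
          using signal_near_center[OF J(1,2) w z(1)[unfolded S_def]] dz by (simp add: r_def)
        then show "t \<le> \<bar>iter_deriv (f w) vs y - iter_deriv (f w') vs y\<bar> powr p"
          unfolding t_def using pos p by (intro powr_mono2) auto
      qed
      finally show ?thesis .
    qed (auto simp: indicator_def)
  qed
  finally show ?thesis unfolding S_def t_def r_def .
qed

text \<open>
  If two hypotheses had both a small \<open>L\<^sup>p\<close> loss, their derivatives would be close in \<open>L\<^sup>p\<close>, hence they would differ
  in few bumps, as each bump occupies a share of the volume of order \<open>1 / card J\<close>.  The grid has
  \<open>R\<^sup>d / card J \<le> (4 * \<rho> * h)\<^sup>d\<close>, and \<open>a\<close> is 11 times the ratio of this volume to that of the ball in which the signal
  is guaranteed; the factor 11 makes the share of differing bumps at most \<open>2 / 11 < 3 / 16\<close>.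
\<close>

lemma Lp_lower_bound:
  defines "a \<equiv> 11 * (4 * \<rho>) ^ CARD('d) / (unit_ball_vol (real CARD('d)) * min \<rho> (\<kappa> / (2 * B)) ^ CARD('d))"
  assumes small: "\<epsilon> * \<tau> \<le> 1 / 256" and C: "C > 0" "C * (c * \<kappa>) \<ge> 4 * (a + 1)" and h: "2 * (\<rho> * h) \<le> R"
    and p: "p \<ge> 1" and g: "\<And>y. y \<in> space sample_space \<Longrightarrow> g y \<in> borel_measurable (lebesgue_on (cube R))"
  shows "(SUP f\<in>holder_class \<beta> L L\<beta>. obs_prob P n x f (\<lambda>y.
    ennreal (C * R powr (- real CARD('d) / p)) * Lp_norm p (lebesgue_on (cube R)) (\<lambda>z. g y z - iter_deriv f vs z)
      \<ge> ennreal (h powr (\<beta> - length vs)))) \<ge> 1 / 4"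
proof -
  let ?d = "CARD('d)"
  define q where "q = h powr (\<beta> - length vs)"
  let ?M = "lebesgue_on (cube R) :: (real^'d) measure"
  let ?E = "\<lambda>f y. ennreal (C * R powr (- real CARD('d) / p)) * Lp_norm p ?M (\<lambda>z. g y z - iter_deriv f vs z) \<ge> ennreal q"
  define V where "V = unit_ball_vol (real CARD('d)) * min \<rho> (\<kappa> / (2 * B)) ^ CARD('d)"
  have q: "q > 0" using pos by (simp add: q_def)
  have V: "V > 0" using pos by (simp add: V_def)
  have a: "a = 11 * (4 * \<rho>) ^ ?d / V" "a > 0" using V pos by (simp_all add: a_def V_def)
  have \<rho>h: "\<rho> * h > 0" using pos by simp
  obtain J :: "(real^'d) set" where J: "finite J" "separated (\<rho> * h) J"
    "\<And>z. z \<in> J \<Longrightarrow> ball z (\<rho> * h) \<subseteq> cube R" "real (card J) \<ge> (R / (4 * (\<rho> * h))) ^ CARD('d)"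
    using card_grid_cube[OF \<rho>h h, where 'd='d] by blast
  have cube: "z \<in> cube R" if "z \<in> J" for z using J(3)[OF that] \<rho>h by auto
  have gp: "(R / (4 * (\<rho> * h))) ^ CARD('d) > 0" using \<rho>h pos' by simp
  have cardJ: "card J > 0" using J(4) gp by linarith
  have RJ: "R ^ ?d \<le> real (card J) * (4 * \<rho>) ^ ?d * h ^ ?d"
    using J(4) pos by (simp add: field_simps power_divide power_mult_distrib)
  have F: "iter_deriv (f w) vs \<in> borel_measurable ?M" for w
    using continuous_iter_deriv_f sets_cube
    by (intro continuous_imp_measurable_on_sets_lebesgue) (auto intro: continuous_on_subset)
  have "\<exists>w\<subseteq>J. outer_measure_of (law w) {y\<in>space sample_space. ?E (f w) y} \<ge> ennreal (1 / 4)"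
  proof (rule assouad)
    show "finite J" "J \<noteq> {}" using J cardJ by auto
    show "prob_space (law w)" "sets (law w) = sets sample_space" for w
      by (rule law_prob_space sets_law)+
    show "measure (law (insert z w)) A - measure (law w) A \<le> 1 / 8"
      if "z \<in> J" "w \<subseteq> J - {z}" "A \<in> sets sample_space" for z w A
    proof (rule law_close[OF _ _ cube[OF that(1)] that(3) small])
      show "finite w" using that J(1) finite_subset by blast
      show "z \<notin> w" using that by auto
    qed
    fix w w' y assume w: "w \<subseteq> J" "w' \<subseteq> J" and y: "y \<in> space sample_space" and E: "\<not> ?E (f w) y" "\<not> ?E (f w') y"
    note gm = g[OF y]
    let ?m = "real (card ((w - w') \<union> (w' - w)))"
    let ?T = "q powr p * R ^ ?d / C powr p"
    have "ennreal (?m * ((c * \<kappa> / 2 * q) powr p * (V * h ^ ?d)))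
      \<le> (\<integral>\<^sup>+ x. ennreal (\<bar>iter_deriv (f w) vs x - iter_deriv (f w') vs x\<bar> powr p) \<partial>?M)"
      using hamming_le_Lp_loss[OF J(2,1,3) w p] by (simp add: q_def V_def power_mult_distrib mult_ac)
    also have "\<dots> = (\<integral>\<^sup>+ x. ennreal (\<bar>(g y x - iter_deriv (f w) vs x) - (g y x - iter_deriv (f w') vs x)\<bar> powr p) \<partial>?M)"
      by (intro nn_integral_cong) (simp add: abs_minus_commute)
    also have "\<dots> \<le> ennreal (2 powr p) * ((\<integral>\<^sup>+ x. ennreal (\<bar>g y x - iter_deriv (f w) vs x\<bar> powr p) \<partial>?M) +
        (\<integral>\<^sup>+ x. ennreal (\<bar>g y x - iter_deriv (f w') vs x\<bar> powr p) \<partial>?M))"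
      using gm F by (intro nn_integral_powr_triangle p borel_measurable_diff)
    also have "\<dots> \<le> ennreal (2 powr p) * (ennreal ?T + ennreal ?T)"
      using nn_integral_powr_le_of_Lp_norm[OF p C(1) pos'(1) q E(1)]
        nn_integral_powr_le_of_Lp_norm[OF p C(1) pos'(1) q E(2)]
      by (intro mult_left_mono add_mono) auto
    also have "\<dots> = ennreal (2 powr p * (?T + ?T))"
      using pos' C by (simp flip: ennreal_plus ennreal_mult)
    finally have "?m * ((c * \<kappa> / 2 * q) powr p * (V * h ^ ?d)) \<le> 2 powr p * (?T + ?T)"
      using pos' C by (simp add: ennreal_le_iff)
    \<comment> \<open>With this \<open>X\<close> the powers of 2, \<open>q\<close> and \<open>C\<close> on both sides cancel.\<close>
    moreover define X where "X = C * (c * \<kappa>) / 4"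
    have X: "X \<ge> a + 1" using C by (simp add: X_def)
    have "c * \<kappa> / 2 * q = 2 * X * q / C" using C by (simp add: X_def field_simps)
    then have "(c * \<kappa> / 2 * q) powr p = 2 powr p * X powr p * q powr p / C powr p"
      using X a q C by (simp add: powr_mult powr_divide)
    ultimately have "(2 powr p * q powr p / C powr p) * (?m * X powr p * (V * h ^ ?d))
        \<le> (2 powr p * q powr p / C powr p) * (2 * R ^ ?d)"
      by (simp add: mult_ac)
    then have "?m * X powr p * (V * h ^ ?d) \<le> 2 * R ^ ?d"
      using q C by (subst (asm) mult_le_cancel_left_pos) auto
    also have "\<dots> \<le> 2 * (real (card J) * (4 * \<rho>) ^ ?d * h ^ ?d)" using RJ by simp
    also have "(4 * \<rho>) ^ ?d = a * V / 11" using V a by simp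
    finally have "(?m * X powr p) * (V * h ^ ?d) \<le> (2 / 11 * a * real (card J)) * (V * h ^ ?d)"
      by (simp add: mult_ac)
    then have 1: "?m * X powr p \<le> 2 / 11 * a * real (card J)"
      using V pos by (subst (asm) mult_le_cancel_right_pos) auto
    have "a + 1 \<le> X powr 1" using X a by simp
    also have "\<dots> \<le> X powr p" using X a p by (intro powr_mono) auto
    finally have "?m * (a + 1) \<le> ?m * X powr p" by (intro mult_left_mono) auto
    also note 1
    also have "2 / 11 * a * real (card J) \<le> 2 / 11 * real (card J) * (a + 1)" by (simp add: algebra_simps)
    finally have "?m \<le> 2 / 11 * real (card J)" using a by (subst (asm) mult_le_cancel_right_pos) auto
    also have "\<dots> < 3 / 16 * real (card J)" using cardJ by simp
    finally show "16 * ?m < 3 * real (card J)" by simp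
  qed
  then obtain w where w: "w \<subseteq> J" "outer_measure_of (law w) {y\<in>space sample_space. ?E (f w) y} \<ge> ennreal (1 / 4)"
    by blast
  show ?thesis using holder_witness[OF J(2,1) w(1), of ?E, OF w(2)] unfolding q_def .
qed

end

section \<open>Choice of the bandwidth and the rates\<close>

text \<open>
  The bandwidth tends to 0, but slowly enough that the balls of the size of a bump may contain more than one
  design point: \<open>n * h n ^ d\<close> is at least of the order of the power \<open>1 - d / (2 * \<beta> + d)\<close> of \<open>n\<close>, which
  tends to infinity.
\<close>

lemma eventually_bandwidth_small:
  fixes \<tau> :: "nat \<Rightarrow> real" and L :: "nat \<Rightarrow> real" and \<beta> R \<rho> Cc b :: real and d :: nat
  assumes lim: "(\<lambda>n. \<tau> n / real n) \<longlonglongrightarrow> 0" and \<tau>: "eventually (\<lambda>n. \<tau> n \<ge> 1) sequentially"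
    and pos: "\<beta> > 0" "R > 0" "\<rho> > 0" "Cc > 0" "b > 0" and L: "\<And>k. k \<le> strict_floor \<beta> \<Longrightarrow> L k > 0"
  defines "h \<equiv> \<lambda>n. (R ^ d * \<tau> n / real n) powr (1 / (2 * \<beta> + real d))"
  shows "eventually (\<lambda>n. \<tau> n \<ge> 1 \<and> h n > 0 \<and> 2 * (\<rho> * h n) \<le> R \<and> 1 / real n \<le> Cc * (\<rho> * h n / R) ^ d \<and>
    (\<forall>k\<le>strict_floor \<beta>. b * h n powr (\<beta> - k) \<le> L k)) sequentially"
proof -
  define D where "D = 2 * \<beta> + real d"
  have D: "D > 0" "real d / D < 1" using pos by (auto simp: D_def add_pos_nonneg)
  have npos: "eventually (\<lambda>n. real n > 0) sequentially" using eventually_gt_at_top[of 0] by eventually_elim simp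
  have hpos: "eventually (\<lambda>n. h n > 0) sequentially"
    using npos \<tau>
  proof eventually_elim
    case (elim n)
    then have "R ^ d * \<tau> n / real n > 0" using pos by simp
    then show ?case unfolding h_def powr_gt_zero by (rule less_imp_neq[symmetric])
  qed
  have h0: "h \<longlonglongrightarrow> 0"
    unfolding h_def
  proof (rule tendsto_zero_powrI)
    show "(\<lambda>n. R ^ d * \<tau> n / real n) \<longlonglongrightarrow> 0" using tendsto_mult_left[OF lim, of "R ^ d"] by simp
    show "eventually (\<lambda>n. 0 \<le> R ^ d * \<tau> n / real n) sequentially"
      using \<tau> by eventually_elim (use pos in simp)
    show "0 < 1 / (2 * \<beta> + real d)" using D by (simp add: D_def)
  qed simp
  have 1: "eventually (\<lambda>n. 2 * (\<rho> * h n) \<le> R) sequentially"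
  proof -
    have "(\<lambda>n. 2 * (\<rho> * h n)) \<longlonglongrightarrow> 2 * (\<rho> * 0)" by (intro tendsto_intros h0)
    from order_tendstoD(2)[OF this, of R] show ?thesis
      using pos by (auto elim!: eventually_mono)
  qed
  have 2: "eventually (\<lambda>n. \<forall>k\<in>{..strict_floor \<beta>}. b * h n powr (\<beta> - k) \<le> L k) sequentially"
  proof (intro eventually_ball_finite ballI)
    fix k assume k: "k \<in> {..strict_floor \<beta>}"
    then have k': "\<beta> - k > 0" using strict_floor_bounds(1)[OF pos(1)] by auto
    have "(\<lambda>n. h n powr (\<beta> - k)) \<longlonglongrightarrow> 0"
      by (rule tendsto_zero_powrI[OF h0 tendsto_const _ k']) (use hpos in \<open>auto elim!: eventually_mono\<close>)
    from tendsto_mult_left[OF this, of b] have "(\<lambda>n. b * h n powr (\<beta> - k)) \<longlonglongrightarrow> 0" by simp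
    from order_tendstoD(2)[OF this, of "L k"] show "eventually (\<lambda>n. b * h n powr (\<beta> - k) \<le> L k) sequentially"
      using L[of k] k by (auto elim!: eventually_mono)
  qed simp
  have 3: "eventually (\<lambda>n. 1 / real n \<le> Cc * (\<rho> * h n / R) ^ d) sequentially"
  proof -
    have "filterlim (\<lambda>n. real n powr (1 - d / D)) at_top sequentially"
      using D(2) by real_asymp
    then have "eventually (\<lambda>n. real n powr (1 - d / D) \<ge> R ^ d / (Cc * \<rho> ^ d * (R ^ d) powr (d / D))) sequentially"
      by (simp add: filterlim_at_top)
    then show ?thesis using npos \<tau>
    proof eventually_elim
      case (elim n)
      have "R ^ d * 1 / real n \<le> R ^ d * \<tau> n / real n"
        using elim pos by (intro divide_right_mono mult_left_mono) auto
      then have "(R ^ d / real n) powr (d / D) \<le> (R ^ d * \<tau> n / real n) powr (d / D)"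
        using elim pos D by (intro powr_mono2) auto
      also have "\<dots> = h n powr real d" by (simp add: h_def powr_powr D_def)
      also have "\<dots> = h n ^ d"
      proof -
        have "R ^ d * \<tau> n / real n > 0" using pos elim by simp
        then have "h n > 0" unfolding h_def powr_gt_zero by (rule less_imp_neq[symmetric])
        then show ?thesis by (simp add: powr_realpow)
      qed
      finally have hd: "(R ^ d) powr (d / D) / real n powr (d / D) \<le> h n ^ d"
        using pos elim by (simp add: powr_divide)
      have "real n powr (1 - d / D) = real n / real n powr (d / D)"
        using elim by (simp add: powr_diff)
      then have "R ^ d \<le> Cc * \<rho> ^ d * real n * ((R ^ d) powr (d / D) / real n powr (d / D))"
        using elim(1) pos by (simp add: field_simps)
      also have "\<dots> \<le> Cc * \<rho> ^ d * real n * h n ^ d"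
        using hd pos by (intro mult_left_mono) auto
      finally show ?case using pos elim by (simp add: field_simps power_divide power_mult_distrib)
    qed
  qed
  show ?thesis using 1 2 3 hpos \<tau> by eventually_elim auto
qed

text \<open>
  With \<open>D = 2 * \<beta> + d\<close> the logarithm of \<open>1 / h\<close> is \<open>(ln n - ln (ln n)) / D\<close> up to a constant, which eventually exceeds
  \<open>ln n / (2 * D)\<close>.
\<close>

lemma eventually_log_grid_large:
  fixes R \<rho> D :: real and d :: nat
  assumes pos: "R > 0" "\<rho> > 0" "D > 0" and d: "real d > 0"
  shows "eventually (\<lambda>n. d / (4 * D) * ln (real n) + ln 2 \<le>
    3 / 4 * (d * ln (R / (4 * (\<rho> * (R ^ d * ln (real n) / real n) powr (1 / D)))))) sequentially"
proof -
  define c where "c = ln (4 * \<rho>) + d / D * ln R - ln R"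
  have "filterlim (\<lambda>n. ln (real n) - 2 * ln (ln (real n))) at_top sequentially" by real_asymp
  then have 1: "eventually (\<lambda>n. ln (real n) - 2 * ln (ln (real n)) \<ge> 2 * D * c) sequentially"
    by (simp add: filterlim_at_top)
  have "filterlim (\<lambda>n. ln (real n)) at_top sequentially" by real_asymp
  then have 2: "eventually (\<lambda>n. ln (real n) \<ge> 8 * D / d * ln 2) sequentially"
    by (simp add: filterlim_at_top)
  show ?thesis using 1 2 eventually_gt_at_top[of 1]
  proof eventually_elim
    case (elim n)
    have n: "real n > 1" "ln (real n) > 0" using elim by auto
    define u where "u = R ^ d * ln (real n) / real n"
    have u: "u > 0" using pos n by (simp add: u_def)
    have lnu: "ln u = d * ln R + ln (ln (real n)) - ln (real n)"
      using pos n by (simp add: u_def ln_div ln_mult ln_realpow)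
    have "ln (R / (4 * (\<rho> * u powr (1 / D)))) =
        ln R - (ln (4 * \<rho>) + (d * ln R + ln (ln (real n)) - ln (real n)) / D)"
      unfolding lnu[symmetric] using pos u by (simp add: ln_div ln_mult ln_powr)
    also have "\<dots> = (ln (real n) - ln (ln (real n))) / D - c"
      using pos by (simp add: c_def field_simps)
    also have "\<dots> \<ge> ln (real n) / (2 * D)"
      using elim(1) pos by (simp add: field_simps)
    finally have "3 / 4 * (d * (ln (real n) / (2 * D))) \<le> 3 / 4 * (d * ln (R / (4 * (\<rho> * u powr (1 / D)))))"
      using d by (intro mult_left_mono) auto
    moreover have "d / (4 * D) * ln (real n) + ln 2 \<le> 3 / 4 * (d * (ln (real n) / (2 * D)))"
      using elim(2) pos d by (simp add: field_simps)
    ultimately show ?case unfolding u_def by linarith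
  qed
qed

theorem corollaryB10:
  fixes \<beta> L\<^sub>\<beta> C\<^sub>n\<^sub>o\<^sub>i\<^sub>s\<^sub>e C\<^sub>c\<^sub>v\<^sub>r\<^sub>s\<^sub>c p :: real
  assumes "\<beta> > 0" "L\<^sub>\<beta> > 0" "C\<^sub>n\<^sub>o\<^sub>i\<^sub>s\<^sub>e > 0" "C\<^sub>c\<^sub>v\<^sub>r\<^sub>s\<^sub>c > 0" "p \<ge> 1"
  shows "\<exists>C::real>0. \<forall>(L :: nat \<Rightarrow> real) (R::real).
    (\<forall>k\<le>strict_floor \<beta>. L k > 0) \<and> R > 0 \<longrightarrow>
    (\<exists>n\<^sub>0::nat>0. \<forall>(vs :: (real ^ 'd) list) (P :: real measure) (n::nat) (x :: nat \<Rightarrow> real ^ 'd).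
      real (length vs) < \<beta> \<and> (\<forall>v\<in>set vs. norm v = 1) \<and>
      centered_distribution P \<and> noise_cond C\<^sub>n\<^sub>o\<^sub>i\<^sub>s\<^sub>e P \<and>
      cover_scaled C\<^sub>c\<^sub>v\<^sub>r\<^sub>s\<^sub>c R n x \<and> n \<ge> n\<^sub>0 \<longrightarrow>
      (let d = CARD('d); s = length vs;
           \<F> = (holder_class \<beta> L L\<^sub>\<beta> :: (real ^ 'd \<Rightarrow> real) set);
           \<gamma> = (\<beta> - real s) / (2 * \<beta> + real d)
       in
        (\<forall>x\<^sub>0\<in>cube R.
          (INF g\<in>estimators n. SUP f\<in>\<F>. obs_prob P n x f (\<lambda>y.
             C * \<bar>g y x\<^sub>0 - iter_deriv f vs x\<^sub>0\<bar> \<ge> (R ^ d / real n) powr \<gamma>)) \<ge> 1 / 4) \<and>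
        (INF g\<in>estimators n. SUP f\<in>\<F>. obs_prob P n x f (\<lambda>y.
           ennreal C * (SUP z\<in>cube R. ennreal \<bar>g y z - iter_deriv f vs z\<bar>)
             \<ge> ennreal ((R ^ d * ln (real n) / real n) powr \<gamma>))) \<ge> 1 / 4 \<and>
        (INF g\<in>path_measurable_estimators R n. SUP f\<in>\<F>. obs_prob P n x f (\<lambda>y.
           ennreal (C * R powr (- real d / p)) *
             Lp_norm p (lebesgue_on (cube R)) (\<lambda>z. g y z - iter_deriv f vs z)
               \<ge> ennreal ((R ^ d / real n) powr \<gamma>))) \<ge> 1 / 4))"
proof -
  let ?d = "CARD('d)"
  define D where "D = 2 * \<beta> + real ?d"
  have D: "D > 0" using assms(1) by (simp add: D_def add_pos_nonneg)
  obtain B \<kappa> \<rho> where con: "B > 0" "\<kappa> > 0" "\<rho> > 0" and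
    kernel: "\<And>vs :: (real^'d) list. length vs \<le> strict_floor \<beta> \<Longrightarrow> (\<And>v. v \<in> set vs \<Longrightarrow> norm v = 1) \<Longrightarrow>
      \<exists>K. bounded_derivs (Suc (strict_floor \<beta>)) B K \<and> \<bar>iter_deriv K vs 0\<bar> \<ge> \<kappa> \<and>
        (\<forall>ws x. norm x \<ge> \<rho> \<longrightarrow> iter_deriv K ws x = 0)"
    using kernel_exists[of "strict_floor \<beta>", where 'd='d] by blast
  \<comment> \<open>The first bound is the information that \<open>law_close\<close> admits, the second one the share of \<open>ln n\<close> that \<open>eventually_log_grid_large\<close> leaves.\<close>
  define \<epsilon> where "\<epsilon> = min (1 / 256) (?d / (4 * D))"
  have \<epsilon>: "\<epsilon> > 0" using D by (simp add: \<epsilon>_def)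
  define e where "e = \<epsilon> / (C\<^sub>n\<^sub>o\<^sub>i\<^sub>s\<^sub>e * B\<^sup>2 * C\<^sub>c\<^sub>v\<^sub>r\<^sub>s\<^sub>c * \<rho> ^ ?d)"
  have e: "e > 0" using \<epsilon> con assms by (simp add: e_def)
  \<comment> \<open>The first bound keeps the bumps in the Hoelder class, the second one limits their information to \<open>\<epsilon>\<close>.\<close>
  define c where "c = min (L\<^sub>\<beta> / (4 * B)) (sqrt e)"
  have c: "c > 0" using con assms e by (simp add: c_def)
  have c1: "4 * B * c \<le> L\<^sub>\<beta>"
  proof -
    have "c \<le> L\<^sub>\<beta> / (4 * B)" by (simp add: c_def)
    then show ?thesis using con by (simp add: field_simps)
  qed
  have c2: "C\<^sub>n\<^sub>o\<^sub>i\<^sub>s\<^sub>e * c\<^sup>2 * B\<^sup>2 * C\<^sub>c\<^sub>v\<^sub>r\<^sub>s\<^sub>c * \<rho> ^ ?d \<le> \<epsilon>"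
  proof -
    have "c\<^sup>2 \<le> (sqrt e)\<^sup>2" using c by (intro power_mono) (auto simp: c_def)
    then have "c\<^sup>2 \<le> \<epsilon> / (C\<^sub>n\<^sub>o\<^sub>i\<^sub>s\<^sub>e * B\<^sup>2 * C\<^sub>c\<^sub>v\<^sub>r\<^sub>s\<^sub>c * \<rho> ^ ?d)" using e by (simp add: e_def)
    then show ?thesis using con assms by (simp add: pos_le_divide_eq mult_ac)
  qed
  define a where "a = 11 * (4 * \<rho>) ^ ?d / (unit_ball_vol (real ?d) * min \<rho> (\<kappa> / (2 * B)) ^ ?d)"
  have a: "a \<ge> 0" using con by (simp add: a_def)
  \<comment> \<open>All three risks are served by the requirement of the \<open>L\<^sup>p\<close> risk, which is the strongest.\<close>
  define C where "C = 4 * (a + 1) / (c * \<kappa>)"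
  have C: "C > 0" "C * (c * \<kappa>) = 4 * (a + 1)" using a c con by (simp_all add: C_def)
  have C4: "C * (c * \<kappa>) \<ge> 4" using C a by simp
  show ?thesis
  proof (intro exI[of _ C] conjI C(1) allI impI)
    fix L :: "nat \<Rightarrow> real" and R :: real
    assume LR: "(\<forall>k\<le>strict_floor \<beta>. L k > 0) \<and> R > 0"
    define h where "h = (\<lambda>\<tau> n. (R ^ ?d * \<tau> / real n) powr (1 / D))"
    let ?good = "\<lambda>\<tau> n. \<tau> \<ge> 1 \<and> h \<tau> n > 0 \<and> 2 * (\<rho> * h \<tau> n) \<le> R \<and>
      1 / real n \<le> C\<^sub>c\<^sub>v\<^sub>r\<^sub>s\<^sub>c * (\<rho> * h \<tau> n / R) ^ ?d \<and> (\<forall>k\<le>strict_floor \<beta>. 2 * B * c * h \<tau> n powr (\<beta> - k) \<le> L k)"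
    have good1: "eventually (\<lambda>n. ?good 1 n) sequentially"
    proof -
      have "(\<lambda>n. 1 / real n) \<longlonglongrightarrow> 0" by real_asymp
      then show ?thesis unfolding h_def D_def
        using assms con LR c by (intro eventually_bandwidth_small) auto
    qed
    have good2: "eventually (\<lambda>n. ?good (ln (real n)) n) sequentially"
    proof -
      have "(\<lambda>n. ln (real n) / real n) \<longlonglongrightarrow> 0" by real_asymp
      moreover have "eventually (\<lambda>n. ln (real n) \<ge> 1) sequentially" by real_asymp
      ultimately show ?thesis unfolding h_def D_def
        using assms con LR c by (intro eventually_bandwidth_small) auto
    qed
    have grid: "eventually (\<lambda>n. ?d / (4 * D) * ln (real n) + ln 2 \<le>
        3 / 4 * (?d * ln (R / (4 * (\<rho> * h (ln (real n)) n))))) sequentially"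
      unfolding h_def using con LR D by (intro eventually_log_grid_large) auto
    have "eventually (\<lambda>n. ?good 1 n \<and> ?good (ln (real n)) n \<and> ?d / (4 * D) * ln (real n) + ln 2 \<le>
        3 / 4 * (?d * ln (R / (4 * (\<rho> * h (ln (real n)) n))))) sequentially"
      by (intro eventually_conj good1 good2 grid)
    then obtain n1 where n1: "\<And>n. n \<ge> n1 \<Longrightarrow> ?good 1 n" "\<And>n. n \<ge> n1 \<Longrightarrow> ?good (ln (real n)) n"
      "\<And>n. n \<ge> n1 \<Longrightarrow> ?d / (4 * D) * ln (real n) + ln 2 \<le>
        3 / 4 * (?d * ln (R / (4 * (\<rho> * h (ln (real n)) n))))"
      unfolding eventually_sequentially by blast
    show "\<exists>n\<^sub>0::nat>0. \<forall>(vs :: (real ^ 'd) list) (P :: real measure) (n::nat) (x :: nat \<Rightarrow> real ^ 'd).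
      real (length vs) < \<beta> \<and> (\<forall>v\<in>set vs. norm v = 1) \<and>
      centered_distribution P \<and> noise_cond C\<^sub>n\<^sub>o\<^sub>i\<^sub>s\<^sub>e P \<and>
      cover_scaled C\<^sub>c\<^sub>v\<^sub>r\<^sub>s\<^sub>c R n x \<and> n \<ge> n\<^sub>0 \<longrightarrow>
      (let d = CARD('d); s = length vs;
           \<F> = (holder_class \<beta> L L\<^sub>\<beta> :: (real ^ 'd \<Rightarrow> real) set);
           \<gamma> = (\<beta> - real s) / (2 * \<beta> + real d)
       in
        (\<forall>x\<^sub>0\<in>cube R.
          (INF g\<in>estimators n. SUP f\<in>\<F>. obs_prob P n x f (\<lambda>y.
             C * \<bar>g y x\<^sub>0 - iter_deriv f vs x\<^sub>0\<bar> \<ge> (R ^ d / real n) powr \<gamma>)) \<ge> 1 / 4) \<and>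
        (INF g\<in>estimators n. SUP f\<in>\<F>. obs_prob P n x f (\<lambda>y.
           ennreal C * (SUP z\<in>cube R. ennreal \<bar>g y z - iter_deriv f vs z\<bar>)
             \<ge> ennreal ((R ^ d * ln (real n) / real n) powr \<gamma>))) \<ge> 1 / 4 \<and>
        (INF g\<in>path_measurable_estimators R n. SUP f\<in>\<F>. obs_prob P n x f (\<lambda>y.
           ennreal (C * R powr (- real d / p)) *
             Lp_norm p (lebesgue_on (cube R)) (\<lambda>z. g y z - iter_deriv f vs z)
               \<ge> ennreal ((R ^ d / real n) powr \<gamma>))) \<ge> 1 / 4)"
    proof (intro exI[of _ "max 1 n1"] conjI allI impI)
      show "max 1 n1 > 0" by simp
      fix vs :: "(real^'d) list" and P :: "real measure" and n :: nat and x :: "nat \<Rightarrow> real^'d"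
      assume model: "real (length vs) < \<beta> \<and> (\<forall>v\<in>set vs. norm v = 1) \<and>
        centered_distribution P \<and> noise_cond C\<^sub>n\<^sub>o\<^sub>i\<^sub>s\<^sub>e P \<and> cover_scaled C\<^sub>c\<^sub>v\<^sub>r\<^sub>s\<^sub>c R n x \<and> n \<ge> max 1 n1"
      then have n: "n > 0" "n \<ge> n1" by auto
      obtain K where K: "bounded_derivs (Suc (strict_floor \<beta>)) B K" "\<bar>iter_deriv K vs 0\<bar> \<ge> \<kappa>"
        "\<And>ws x. norm x \<ge> \<rho> \<Longrightarrow> iter_deriv K ws x = 0"
        using kernel[of vs] model le_strict_floor[OF assms(1), of "length vs"] by blast
      have setting: "regression_bumps \<beta> B \<kappa> \<rho> c (h \<tau> n) K vs R \<tau> \<epsilon> C\<^sub>n\<^sub>o\<^sub>i\<^sub>s\<^sub>e C\<^sub>c\<^sub>v\<^sub>r\<^sub>s\<^sub>c L\<^sub>\<beta> L n x P"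
        if good: "?good \<tau> n" for \<tau>
      proof -
        have g: "\<tau> \<ge> 1" "h \<tau> n > 0" "1 / real n \<le> C\<^sub>c\<^sub>v\<^sub>r\<^sub>s\<^sub>c * (\<rho> * h \<tau> n / R) ^ ?d"
          "\<And>k. k \<le> strict_floor \<beta> \<Longrightarrow> 2 * B * c * h \<tau> n powr (\<beta> - k) \<le> L k"
          using good by blast+
        have P: "prob_space P" "sets P = sets borel"
          using model unfolding centered_distribution_def by blast+
        have m: "real (length vs) < \<beta>" "\<And>v. v \<in> set vs \<Longrightarrow> norm v = 1" "noise_cond C\<^sub>n\<^sub>o\<^sub>i\<^sub>s\<^sub>e P"
          "cover_scaled C\<^sub>c\<^sub>v\<^sub>r\<^sub>s\<^sub>c R n x"
          using model by blast+
        have R: "R > 0" using LR by blast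
        have \<tau>: "\<tau> > 0" using g(1) by linarith
        have h: "h \<tau> n = (R ^ ?d * \<tau> / real n) powr (1 / (2 * \<beta> + real ?d))" by (simp only: h_def D_def)
        show ?thesis
          by (intro regression_bumps.intro bump_kernel.intro regression_bumps_axioms.intro)
            (fact assms con c g K P m R n(1) c1 c2 \<tau> h)+
      qed
      interpret fixed: regression_bumps \<beta> B \<kappa> \<rho> c "h 1 n" K vs R 1 \<epsilon> C\<^sub>n\<^sub>o\<^sub>i\<^sub>s\<^sub>e C\<^sub>c\<^sub>v\<^sub>r\<^sub>s\<^sub>c L\<^sub>\<beta> L n x P
        by (rule setting[OF n1(1)[OF n(2)]])
      interpret log: regression_bumps \<beta> B \<kappa> \<rho> c "h (ln (real n)) n" K vs R "ln (real n)" \<epsilon> C\<^sub>n\<^sub>o\<^sub>i\<^sub>s\<^sub>e C\<^sub>c\<^sub>v\<^sub>r\<^sub>s\<^sub>c L\<^sub>\<beta> L n x P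
        by (rule setting[OF n1(2)[OF n(2)]])
      have small: "\<epsilon> * 1 \<le> 1 / 256" by (simp add: \<epsilon>_def)
      have log_small: "\<epsilon> * ln (real n) + ln 2 \<le> 3 / 4 * (?d * ln (R / (4 * (\<rho> * h (ln (real n)) n))))"
      proof -
        have "\<epsilon> * ln (real n) \<le> ?d / (4 * D) * ln (real n)"
          using n1(2)[OF n(2)] by (intro mult_right_mono) (auto simp: \<epsilon>_def)
        then show ?thesis using n1(3)[OF n(2)] by linarith
      qed
      have h_le: "2 * (\<rho> * h 1 n) \<le> R" "2 * (\<rho> * h (ln (real n)) n) \<le> R"
        using n1(1,2)[OF n(2)] by auto
      have rate1: "(R ^ ?d / real n) powr ((\<beta> - real (length vs)) / (2 * \<beta> + real ?d)) = h 1 n powr (\<beta> - length vs)"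
        using fixed.rate by simp
      show "let d = CARD('d); s = length vs;
           \<F> = (holder_class \<beta> L L\<^sub>\<beta> :: (real ^ 'd \<Rightarrow> real) set);
           \<gamma> = (\<beta> - real s) / (2 * \<beta> + real d)
       in
        (\<forall>x\<^sub>0\<in>cube R.
          (INF g\<in>estimators n. SUP f\<in>\<F>. obs_prob P n x f (\<lambda>y.
             C * \<bar>g y x\<^sub>0 - iter_deriv f vs x\<^sub>0\<bar> \<ge> (R ^ d / real n) powr \<gamma>)) \<ge> 1 / 4) \<and>
        (INF g\<in>estimators n. SUP f\<in>\<F>. obs_prob P n x f (\<lambda>y.
           ennreal C * (SUP z\<in>cube R. ennreal \<bar>g y z - iter_deriv f vs z\<bar>)
             \<ge> ennreal ((R ^ d * ln (real n) / real n) powr \<gamma>))) \<ge> 1 / 4 \<and>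
        (INF g\<in>path_measurable_estimators R n. SUP f\<in>\<F>. obs_prob P n x f (\<lambda>y.
           ennreal (C * R powr (- real d / p)) *
             Lp_norm p (lebesgue_on (cube R)) (\<lambda>z. g y z - iter_deriv f vs z)
               \<ge> ennreal ((R ^ d / real n) powr \<gamma>))) \<ge> 1 / 4"
        unfolding Let_def rate1 log.rate[symmetric]
      proof (intro conjI ballI INF_greatest)
        show "(SUP f\<in>holder_class \<beta> L L\<^sub>\<beta>. obs_prob P n x f (\<lambda>y.
            C * \<bar>g y x\<^sub>0 - iter_deriv f vs x\<^sub>0\<bar> \<ge> h 1 n powr (\<beta> - length vs))) \<ge> 1 / 4"
          if "x\<^sub>0 \<in> cube R" for x\<^sub>0 :: "real^'d" and g
          by (rule fixed.pointwise_lower_bound[OF small C(1) C4 that])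
        show "(SUP f\<in>holder_class \<beta> L L\<^sub>\<beta>. obs_prob P n x f (\<lambda>y.
            ennreal C * (SUP z\<in>cube R. ennreal \<bar>g y z - iter_deriv f vs z\<bar>)
              \<ge> ennreal (h (ln (real n)) n powr (\<beta> - length vs)))) \<ge> 1 / 4" for g
          by (rule log.uniform_lower_bound[OF C(1) C4 h_le(2) log_small])
        show "(SUP f\<in>holder_class \<beta> L L\<^sub>\<beta>. obs_prob P n x f (\<lambda>y.
            ennreal (C * R powr (- real ?d / p)) * Lp_norm p (lebesgue_on (cube R)) (\<lambda>z. g y z - iter_deriv f vs z)
              \<ge> ennreal (h 1 n powr (\<beta> - length vs)))) \<ge> 1 / 4"
          if "g \<in> path_measurable_estimators R n" for g
        proof (rule fixed.Lp_lower_bound[OF small C(1) _ h_le(1) assms(5)])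
          show "4 * (11 * (4 * \<rho>) ^ ?d / (unit_ball_vol (real ?d) * min \<rho> (\<kappa> / (2 * B)) ^ ?d) + 1) \<le> C * (c * \<kappa>)"
            using C(2) by (simp add: a_def)
          show "g y \<in> borel_measurable (lebesgue_on (cube R))" if "y \<in> space (\<Pi>\<^sub>M i\<in>{1..n}. borel)" for y
            using \<open>g \<in> path_measurable_estimators R n\<close> that by (simp add: path_measurable_estimators_def)
        qed
      qed
    qed
  qed
qed

end
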